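(* Let $J_0$ be a Jacobi matrix on a finite connected graph $\mathcal G_0$ without vertices of degree $1$. Let $(\mathcal G_n)_{n\ge 1}$ be a sequence of finite covers of $\mathcal G_0$ such that $|V(\mathcal G_n)|\to\infty$, and let $J_n$ be the lift of $J_0$ to $\mathcal G_n$. Let $J_T$ be the lift of $J_0$ to the universal cover $T$ of $\mathcal G_0$ and let $\sigma(J_T)$ denote its spectrum. Then $$\liminf_{n\to\infty}\lambda_2(J_n)\ \ge\ \sup\sigma(J_T).$$
   Context: Graphs are undirected; multiple edges and loops are allowed; vertices of degree $1$ are not allowed (a loop contributes $2$ to the degree). A Jacobi matrix on a graph with vertex set $V$ and edge set $E$ is given by positive numbers $\{a_e\}_{e\in E}$ and real numbers $\{b_v\}_{v\in V}$, and is the operator on $L^2(V)$ with matrix entries $J_{v,v}=b_v+2\sum_{e\text{ a loop at }v}a_e$; $J_{v,w}=\sum_{e\text{ between }v\text{ and }w}a_e$ (sum over all edges joining $v$ and $w$) if $v\ne w$ are neighbors; and $J_{v,w}=0$ if $v\neq w$ are not neighbors. If $\pi:\mathcal G\to\mathcal G_0$ is a graph covering (in the topological sense, graphs being regarded as one-dimensional complexes), the lift of a Jacobi matrix $J_0$ on $\mathcal G_0$ with parameters $\{a_e,b_v\}$ to $\mathcal G$ is the Jacobi matrix on $\mathcal G$ with parameters $a_{\tilde e}=a_{\pi(\tilde e)}$, $b_{\tilde v}=b_{\pi(\tilde v)}$. The universal cover $T$ of $\mathcal G_0$ is a tree, and $J_T$ is a bounded self-adjoint operator on $L^2(V(T))$.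 For a Jacobi matrix $J$ on a finite graph, $\lambda_1(J)\ge\lambda_2(J)\ge\cdots$ are its eigenvalues in decreasing order, counted with multiplicity. Finite covers are not required to be connected. *)

theory Defs
  imports
    "HOL-Analysis.Infinite_Sum"
    "HOL-Library.Extended_Real"
    "HOL-Computational_Algebra.Polynomial"
    "Jordan_Normal_Form.Char_Poly"
    "Graph_Theory.Arc_Walk"
    "Graph_Theory.Digraph_Component"
    "Graph_Theory.Bidirected_Digraph"
begin

text \<open>
  An undirected graph, possibly with loops and multiple edges, is a bidirected digraph
  \<open>(G, r)\<close> (a graph in the sense of Serre): an edge is a pair \<open>{d, r d}\<close> of mutually inverse
  arcs, its two orientations. Since \<open>r\<close> has no fixed point on the arcs, a loop also consists of
  two arcs. The degree of a vertex is therefore \<open>out_degree\<close>, with loops contributing 2, and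
  connectedness is \<open>strongly_connected\<close> (which includes that there is a vertex).
\<close>

definition edges :: "('v, 'd) pre_digraph \<Rightarrow> ('d \<Rightarrow> 'd) \<Rightarrow> 'd set set" where
  "edges G r = {{d, r d} | d. d \<in> arcs G}"

definition edges_between ::
  "('v, 'd) pre_digraph \<Rightarrow> ('d \<Rightarrow> 'd) \<Rightarrow> 'v \<Rightarrow> 'v \<Rightarrow> 'd set set" where
  "edges_between G r v w = {{d, r d} | d. d \<in> arcs G \<and> tail G d = v \<and> head G d = w}"

text \<open>
  The combinatorial form of a topological covering of one-dimensional complexes mapping vertices
  to vertices and edges to edges: a surjective morphism mapping the star of each vertex
  bijectively onto the star of its image. Heads are preserved because tails and inversion are.
\<close>

definition graph_covering ::
  "('v, 'd) pre_digraph \<Rightarrow> ('d \<Rightarrow> 'd) \<Rightarrow> ('v0, 'd0) pre_digraph \<Rightarrow> ('d0 \<Rightarrow> 'd0) \<Rightarrow>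
   ('v \<Rightarrow> 'v0) \<Rightarrow> ('d \<Rightarrow> 'd0) \<Rightarrow> bool" where
  "graph_covering G r G0 r0 pv pd \<longleftrightarrow>
     bidirected_digraph G r \<and> bidirected_digraph G0 r0 \<and>
     pv ` verts G = verts G0 \<and>
     (\<forall>d\<in>arcs G. pd d \<in> arcs G0 \<and> tail G0 (pd d) = pv (tail G d) \<and> pd (r d) = r0 (pd d)) \<and>
     (\<forall>v\<in>verts G. bij_betw pd (out_arcs G v) (out_arcs G0 (pv v)))"

definition reduced_walk :: "('d \<Rightarrow> 'd) \<Rightarrow> 'd list \<Rightarrow> bool" where
  "reduced_walk r p \<longleftrightarrow> (\<forall>i. Suc i < length p \<longrightarrow> p ! Suc i \<noteq> r (p ! i))"

text \<open>
  The library predicate \<open>cycle\<close> cannot be used to exclude circuits, as it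
  counts the walk \<open>[d, r d]\<close> back and forth along one edge as a cycle.
\<close>

definition tree :: "('v, 'd) pre_digraph \<Rightarrow> ('d \<Rightarrow> 'd) \<Rightarrow> bool" where
  "tree G r \<longleftrightarrow> bidirected_digraph G r \<and> strongly_connected G \<and>
     (\<forall>u p. pre_digraph.awalk G u p u \<and> reduced_walk r p \<longrightarrow> p = [])"

text \<open>The universal cover is the simply connected one; a graph is simply connected iff it is a tree.\<close>

definition universal_cover ::
  "('v, 'd) pre_digraph \<Rightarrow> ('d \<Rightarrow> 'd) \<Rightarrow> ('v0, 'd0) pre_digraph \<Rightarrow> ('d0 \<Rightarrow> 'd0) \<Rightarrow>
   ('v \<Rightarrow> 'v0) \<Rightarrow> ('d \<Rightarrow> 'd0) \<Rightarrow> bool" where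
  "universal_cover T r G0 r0 pv pd \<longleftrightarrow> graph_covering T r G0 r0 pv pd \<and> tree T r"

definition jacobi ::
  "('v, 'd) pre_digraph \<Rightarrow> ('d \<Rightarrow> 'd) \<Rightarrow> ('d set \<Rightarrow> real) \<Rightarrow> ('v \<Rightarrow> real) \<Rightarrow> 'v \<Rightarrow> 'v \<Rightarrow> real" where
  "jacobi G r a b v w =
     (if v = w then b v + 2 * (\<Sum>e\<in>edges_between G r v v. a e)
      else (\<Sum>e\<in>edges_between G r v w. a e))"

text \<open>The image of an edge \<open>{d, r d}\<close> under a covering is its image as a set of arcs.\<close>

definition jacobi_lift ::
  "('v, 'd) pre_digraph \<Rightarrow> ('d \<Rightarrow> 'd) \<Rightarrow> ('v \<Rightarrow> 'v0) \<Rightarrow> ('d \<Rightarrow> 'd0) \<Rightarrow>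
   ('d0 set \<Rightarrow> real) \<Rightarrow> ('v0 \<Rightarrow> real) \<Rightarrow> 'v \<Rightarrow> 'v \<Rightarrow> real" where
  "jacobi_lift G r pv pd a b = jacobi G r (\<lambda>e. a (pd ` e)) (\<lambda>v. b (pv v))"

text \<open>
  Matrices indexed by a finite vertex set are transported to \<open>{0..<n}\<close> along an arbitrary
  enumeration; the characteristic polynomial does not depend on it.
\<close>

definition matrix_on :: "'v set \<Rightarrow> ('v \<Rightarrow> 'v \<Rightarrow> real) \<Rightarrow> real mat" where
  "matrix_on V J =
     (let vs = (SOME vs. distinct vs \<and> set vs = V)
      in mat (card V) (card V) (\<lambda>(i, j). J (vs ! i) (vs ! j)))"

text \<open>
  \<open>eigval k V J\<close> is the \<open>k\<close>-th largest eigenvalue, counted with multiplicity, for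
  \<open>1 \<le> k \<le> card V\<close> and symmetric \<open>J\<close> (so that all roots of the
  characteristic polynomial are real).
\<close>

definition eigval :: "nat \<Rightarrow> 'v set \<Rightarrow> ('v \<Rightarrow> 'v \<Rightarrow> real) \<Rightarrow> real" where
  "eigval k V J =
     rev (sorted_list_of_multiset (proots (char_poly (matrix_on V J)))) ! (k - 1)"

text \<open>The complex Hilbert space \<open>L\<^sup>2(V)\<close>, as functions vanishing outside \<open>V\<close>.\<close>

definition ell2 :: "'v set \<Rightarrow> ('v \<Rightarrow> complex) set" where
  "ell2 V = {f. (\<forall>v. v \<notin> V \<longrightarrow> f v = 0) \<and> (\<lambda>v. (cmod (f v))\<^sup>2) summable_on V}"

definition ell2_norm :: "'v set \<Rightarrow> ('v \<Rightarrow> complex) \<Rightarrow> real" where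
  "ell2_norm V f = sqrt (\<Sum>\<^sub>\<infinity>v\<in>V. (cmod (f v))\<^sup>2)"

definition matrix_operator ::
  "'v set \<Rightarrow> ('v \<Rightarrow> 'v \<Rightarrow> real) \<Rightarrow> ('v \<Rightarrow> complex) \<Rightarrow> ('v \<Rightarrow> complex)" where
  "matrix_operator V J f =
     (\<lambda>v. if v \<in> V then (\<Sum>\<^sub>\<infinity>w\<in>V. complex_of_real (J v w) * f w) else 0)"

text \<open>The set of all \<open>z\<close> for which \<open>A - z\<close> has no bounded everywhere defined inverse.\<close>

definition ell2_spectrum ::
  "'v set \<Rightarrow> (('v \<Rightarrow> complex) \<Rightarrow> ('v \<Rightarrow> complex)) \<Rightarrow> complex set" where
  "ell2_spectrum V A =
     {z. \<not> (bij_betw (\<lambda>f v. A f v - z * f v) (ell2 V) (ell2 V) \<and>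
            (\<exists>C. \<forall>f\<in>ell2 V. ell2_norm V f \<le> C * ell2_norm V (\<lambda>v. A f v - z * f v)))}"

end

theory Submission
  imports Defs "Jordan_Normal_Form.Schur_Decomposition" "HOL-Analysis.L2_Norm"
begin

text \<open>
  A finitely supported test function on the tree is pushed forward to a finite cover by taking
  \<open>\<ell>\<^sup>2\<close> norms over the fibres of a covering map. This keeps the norm and does not decrease the
  quadratic form. Every vertex of the fibre over a base point gives such a covering map, and in a
  large cover two of these vertices are so far apart that the two push-forwards have disjoint,
  non-adjacent supports. They span a plane on which the quadratic form exceeds that of the given
  function, so min-max bounds the second eigenvalue from below. Hence if
  \<open>\<lambda>\<^sub>2(J\<^sub>n) < c\<close> for arbitrarily large covers, then \<open>J\<^sub>T \<le> c\<close> as a quadratic form,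
  and \<open>J\<^sub>T - z\<close> is invertible for \<open>Re z > c\<close>.

  A cover is used only through its sheets: \<open>s w d\<close> is the endpoint of the lift starting at \<open>w\<close>
  of the arc \<open>d\<close> of the base graph.
\<close>

section \<open>Eigenvalues of real symmetric matrices\<close>

text \<open>The covers may be disconnected and full of short circuits, so a map from the tree to a
  cover need not be injective on the support \<open>F\<close> of the test function. The fibrewise
  norm copes with arbitrary collisions: the step along a fixed arc maps one fibre injectively into
  another, and nonnegative weights make Cauchy-Schwarz point in the right direction. It also turns a
  complex function into a nonnegative real one, as needed for the real matrices of the covers.

  Separation makes both the norm and the form diagonal on the plane, so strict bounds for the two
  push-forwards extend to all of it. Finding separated copies of \<open>F\<close> is pure counting:
  the base points whose copy comes near a fixed one number at most the square of
  \<open>card F\<close> times \<open>1 + card (arcs G0)\<close>, independently of the cover, while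
  the fibre over the base point grows with the cover.

  On the tree side, the supremum concerns real parts only, so it is enough to exclude each
  \<open>z\<close> whose real part exceeds the liminf.\<close>

lemma symmetric_mat_real_eigenvalue:
  fixes A :: "real mat"
  assumes A: "A \<in> carrier_mat n n" and sym: "A\<^sup>T = A" and n: "n > 0"
  shows "\<exists>x. eigenvalue A x"
proof -
  define B where "B = map_mat complex_of_real A"
  have B: "B \<in> carrier_mat n n" using A by (simp add: B_def)
  have "degree (char_poly B) = n" using degree_monic_char_poly[OF B] by simp
  hence "\<not> constant (poly (char_poly B))" using n by (simp add: constant_degree)
  then obtain z where z: "poly (char_poly B) z = 0"
    using fundamental_theorem_of_algebra by blast
  hence "eigenvalue B z" by (simp add: eigenvalue_root_char_poly[OF B])
  then obtain v where v: "v \<in> carrier_vec n" "v \<noteq> 0\<^sub>v n" "B *\<^sub>v v = z \<cdot>\<^sub>v v"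
    using B unfolding eigenvalue_def eigenvector_def by auto
  have Bi: "B $$ (i, j) = of_real (A $$ (i, j))" if "i < n" "j < n" for i j
    using A that by (simp add: B_def)
  have Asym: "A $$ (i, j) = A $$ (j, i)" if "i < n" "j < n" for i j
    using arg_cong[OF sym, of "\<lambda>M. M $$ (i, j)"] A that by simp
  have Bv: "(\<Sum>j<n. B $$ (i, j) * v $ j) = z * v $ i" if i: "i < n" for i
    using arg_cong[OF v(3), of "\<lambda>w. w $ i"] i B v(1)
    by (simp add: scalar_prod_def atLeast0LessThan)
  \<comment> \<open>\<open>s\<close> is the squared norm of the complex eigenvector
    \<open>v\<close>. The number \<open>z * s\<close> is the Hermitian form of \<open>B\<close> at
    \<open>v\<close>, which equals its own conjugate because \<open>A\<close> is real and symmetric;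
    dividing by the nonzero real \<open>s\<close> makes \<open>z\<close> real, and a real root of
    the characteristic polynomial is an eigenvalue of \<open>A\<close> itself.\<close>
  define s where "s = (\<Sum>i<n. cnj (v $ i) * v $ i)"
  have zs: "z * s = (\<Sum>i<n. \<Sum>j<n. cnj (v $ i) * (B $$ (i, j) * v $ j))"
  proof -
    have "z * s = (\<Sum>i<n. cnj (v $ i) * (z * v $ i))"
      unfolding s_def by (simp add: sum_distrib_left mult_ac)
    also have "\<dots> = (\<Sum>i<n. cnj (v $ i) * (\<Sum>j<n. B $$ (i, j) * v $ j))"
      by (intro sum.cong refl) (simp add: Bv)
    finally show ?thesis by (simp only: sum_distrib_left)
  qed
  also have "\<dots> = (\<Sum>j<n. \<Sum>i<n. cnj (v $ i) * (B $$ (i, j) * v $ j))"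
    by (rule sum.swap)
  also have "\<dots> = (\<Sum>i<n. \<Sum>j<n. cnj (v $ j) * (B $$ (i, j) * v $ i))"
    by (intro sum.cong refl) (auto simp: Bi Asym)
  also have "\<dots> = cnj (\<Sum>i<n. \<Sum>j<n. cnj (v $ i) * (B $$ (i, j) * v $ j))"
    by (auto simp: Bi cnj_sum intro!: sum.cong)
  also have "\<dots> = cnj z * cnj s" by (simp flip: zs)
  also have "cnj s = s" by (simp add: s_def cnj_sum mult.commute)
  finally have eq: "z * s = cnj z * s" .
  have "s = of_real (\<Sum>i<n. (cmod (v $ i))\<^sup>2)"
    by (simp add: s_def complex_norm_square mult.commute del: of_real_power)
  moreover have "(\<Sum>i<n. (cmod (v $ i))\<^sup>2) \<noteq> 0"
    using v(1,2) by (auto simp: sum_nonneg_eq_0_iff)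
  ultimately have "s \<noteq> 0" by (metis of_real_eq_0_iff)
  with eq have "z = cnj z" by simp
  hence "z = of_real (Re z)" by (simp add: complex_eq_iff)
  with z have "poly (map_poly of_real (char_poly A)) (complex_of_real (Re z)) = 0"
    by (metis B_def A of_real_hom.char_poly_hom)
  hence "poly (char_poly A) (Re z) = 0" by simp
  thus ?thesis using eigenvalue_root_char_poly[OF A] by blast
qed

text \<open>This prepares the deflation step of the diagonalization. Gram-Schmidt leaves the first
  vector of the completed basis unchanged, so after normalization the first column is still a
  multiple of \<open>v\<close>; the factor is irrelevant for an eigenvector.\<close>

lemma orthogonal_mat_first_col:
  fixes v :: "real vec"
  assumes v: "v \<in> carrier_vec n" "v \<noteq> 0\<^sub>v n"
  shows "\<exists>W c. W \<in> carrier_mat n n \<and> W\<^sup>T * W = 1\<^sub>m n \<and> col W 0 = c \<cdot>\<^sub>v v"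
proof -
  have n: "n > 0" using v by (cases n) auto
  interpret cof_vec_space n "TYPE(real)" .
  define ws where "ws = gram_schmidt n (basis_completion v)"
  note b = basis_completion[OF v]
  obtain vs where bv: "basis_completion v = v # vs"
    using b(6,7) n by (cases "basis_completion v") auto
  have ws: "set ws \<subseteq> carrier_vec n" "corthogonal ws" "length ws = n"
    using gram_schmidt_result[OF b(2,4,5) refl] b(6) by (auto simp: ws_def)
  have hd: "ws ! 0 = v"
    using gram_schmidt_hd[OF v(1), of vs] ws(3) n by (simp add: ws_def bv hd_conv_nth flip: length_greater_0_conv)
  have wsi: "ws ! i \<in> carrier_vec n" if "i < n" for i using ws that by auto
  define us where "us = map (\<lambda>w. (1 / sqrt (w \<bullet> w)) \<cdot>\<^sub>v w) ws"
  have usi: "us ! i = (1 / sqrt (ws ! i \<bullet> ws ! i)) \<cdot>\<^sub>v (ws ! i)" if "i < n" for i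
    using that ws by (simp add: us_def)
  define W where "W = mat_of_cols n us"
  have len: "length us = n" by (simp add: us_def ws)
  have W: "W \<in> carrier_mat n n" using mat_of_cols_carrier(1)[of n us] by (simp add: W_def len)
  have colW: "col W i = us ! i" if "i < n" for i
    using that len usi[OF that] wsi[OF that] by (simp add: W_def)
  have orth: "(ws ! i \<bullet> ws ! j = 0) = (i \<noteq> j)" if "i < n" "j < n" for i j
    using corthogonalD[OF ws(2), of i j] that ws(3) by simp
  have "W\<^sup>T * W = 1\<^sub>m n"
  proof (rule eq_matI)
    fix i j assume ij: "i < dim_row (1\<^sub>m n)" "j < dim_col (1\<^sub>m n)"
    hence ij: "i < n" "j < n" by auto
    have "(W\<^sup>T * W) $$ (i, j) = us ! i \<bullet> us ! j"
      using ij W by (simp add: colW)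
    also have "\<dots> = 1 / sqrt (ws ! i \<bullet> ws ! i) * (1 / sqrt (ws ! j \<bullet> ws ! j)) * (ws ! i \<bullet> ws ! j)"
      using ij wsi[of i] wsi[of j] by (simp add: usi)
    also have "\<dots> = (if i = j then 1 else 0)"
    proof (cases "i = j")
      case True
      have "ws ! j \<bullet> ws ! j \<ge> 0" by (simp add: scalar_prod_def sum_nonneg)
      moreover have "ws ! j \<bullet> ws ! j \<noteq> 0" using orth ij True by auto
      ultimately show ?thesis using True by (simp add: field_simps)
    next
      case False thus ?thesis using orth[OF ij] by simp
    qed
    finally show "(W\<^sup>T * W) $$ (i, j) = 1\<^sub>m n $$ (i, j)" using ij by simp
  qed (use W in auto)
  moreover have "col W 0 = (1 / sqrt (v \<bullet> v)) \<cdot>\<^sub>v v"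
    using colW[OF n] usi[OF n] hd by simp
  ultimately show ?thesis using W by blast
qed

text \<open>Induction by deflation: in an orthonormal basis that starts with an eigenvector the
  first column of the matrix is cleared below the diagonal, symmetry clears the first row, and the
  remaining symmetric block is one size smaller.\<close>

lemma real_symmetric_mat_diagonalization:
  fixes A :: "real mat"
  assumes "A \<in> carrier_mat n n" and "A\<^sup>T = A"
  shows "\<exists>W D. W \<in> carrier_mat n n \<and> D \<in> carrier_mat n n \<and> W\<^sup>T * W = 1\<^sub>m n \<and> diagonal_mat D \<and>
    A = W * D * W\<^sup>T"
  using assms
proof (induction n arbitrary: A)
  case 0
  thus ?case by (intro exI[of _ "1\<^sub>m 0"]) (auto simp: diagonal_mat_def)
next
  case (Suc n A)
  note A = Suc.prems(1) and sym = Suc.prems(2)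
  obtain e v where v: "v \<in> carrier_vec (Suc n)" "v \<noteq> 0\<^sub>v (Suc n)" "A *\<^sub>v v = e \<cdot>\<^sub>v v"
    using symmetric_mat_real_eigenvalue[OF A sym] A unfolding eigenvalue_def eigenvector_def by auto
  obtain W c where W: "W \<in> carrier_mat (Suc n) (Suc n)" and WW: "W\<^sup>T * W = 1\<^sub>m (Suc n)"
    and col: "col W 0 = c \<cdot>\<^sub>v v"
    using orthogonal_mat_first_col[OF v(1,2)] by blast
  have WW': "W * W\<^sup>T = 1\<^sub>m (Suc n)" using mat_mult_left_right_inverse[OF _ W WW] W by simp
  define B where "B = W\<^sup>T * (A * W)"
  have B: "B \<in> carrier_mat (Suc n) (Suc n)" using W A by (simp add: B_def)
  have Bsym: "B\<^sup>T = B"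
    unfolding B_def using A W sym
    by (subst transpose_mult[of _ "Suc n" "Suc n" _ "Suc n"] | simp add: assoc_mult_mat[of _ "Suc n" "Suc n" _ "Suc n" _ "Suc n"])+
  have Ae: "A *\<^sub>v col W 0 = e \<cdot>\<^sub>v col W 0"
    using v A by (simp add: col mult_mat_vec smult_smult_assoc mult.commute)
  \<comment> \<open>Column 0 of \<open>B\<close> lists the inner products of the columns of
    \<open>W\<close> with the image under \<open>A\<close> of the first column, which is
    \<open>e\<close> times that column.\<close>
  have col0: "B $$ (i, 0) = (if i = 0 then e else 0)" if i: "i < Suc n" for i
  proof -
    have "B $$ (i, 0) = col W i \<bullet> (A *\<^sub>v col W 0)"
      using i W A by (simp add: B_def mult_mat_vec_def)
    also have "\<dots> = e * (col W i \<bullet> col W 0)" unfolding Ae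
      using W by (simp add: scalar_prod_smult_right)
    also have "col W i \<bullet> col W 0 = (W\<^sup>T * W) $$ (i, 0)" using i W by simp
    finally show ?thesis using i by (simp add: WW)
  qed
  have row0: "B $$ (0, i) = (if i = 0 then e else 0)" if i: "i < Suc n" for i
    using col0[OF i] arg_cong[OF Bsym, of "\<lambda>M. M $$ (i, 0)"] B i by simp
  define E where "E = mat 1 1 (\<lambda>_. e)"
  define C where "C = mat n n (\<lambda>(i, j). B $$ (Suc i, Suc j))"
  have E: "E \<in> carrier_mat 1 1" and C: "C \<in> carrier_mat n n" by (simp_all add: E_def C_def)
  have Bblock: "B = four_block_mat E (0\<^sub>m 1 n) (0\<^sub>m n 1) C"
    by (rule eq_matI) (use B col0 row0 in \<open>auto simp: E_def C_def\<close>)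
  have "C\<^sup>T = C"
  proof (rule eq_matI)
    fix i j assume ij: "i < dim_row C" "j < dim_col C"
    thus "C\<^sup>T $$ (i, j) = C $$ (i, j)"
      using arg_cong[OF Bsym, of "\<lambda>M. M $$ (Suc i, Suc j)"] B by (simp add: C_def)
  qed (simp_all add: C_def)
  from Suc.IH[OF C this] obtain P D where P: "P \<in> carrier_mat n n" and D: "D \<in> carrier_mat n n"
    and PP: "P\<^sup>T * P = 1\<^sub>m n" and diag: "diagonal_mat D" and CP: "C = P * D * P\<^sup>T" by blast
  define P' where "P' = four_block_mat (1\<^sub>m 1) (0\<^sub>m 1 n) (0\<^sub>m n 1) P"
  define D' where "D' = four_block_mat E (0\<^sub>m 1 n) (0\<^sub>m n 1) D"
  have P': "P' \<in> carrier_mat (Suc n) (Suc n)" and D': "D' \<in> carrier_mat (Suc n) (Suc n)"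
    using P D E by (auto simp: P'_def D'_def)
  have P'T: "P'\<^sup>T = four_block_mat (1\<^sub>m 1) (0\<^sub>m 1 n) (0\<^sub>m n 1) (P\<^sup>T)"
    unfolding P'_def using P by (subst transpose_four_block_mat[of _ 1 1 _ n _ n]) auto
  have "P'\<^sup>T * P' = four_block_mat (1\<^sub>m 1) (0\<^sub>m 1 n) (0\<^sub>m n 1) (1\<^sub>m n)"
    unfolding P'T unfolding P'_def
    by (subst mult_four_block_mat[of _ 1 1 _ n _ n _ _ 1 _ n]) (use P in \<open>auto simp: PP\<close>)
  also have "\<dots> = 1\<^sub>m (Suc n)" by (rule eq_matI) auto
  finally have P'P': "P'\<^sup>T * P' = 1\<^sub>m (Suc n)" .
  have PD: "P' * D' = four_block_mat E (0\<^sub>m 1 n) (0\<^sub>m n 1) (P * D)"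
    unfolding P'_def D'_def
    by (subst mult_four_block_mat[of _ 1 1 _ n _ n _ _ 1 _ n]) (use P D E in auto)
  have PDP: "P' * D' * P'\<^sup>T = B"
    unfolding PD P'T Bblock CP
    by (subst mult_four_block_mat[of _ 1 1 _ n _ n _ _ 1 _ n]) (use P D E in auto)
  have dD: "diagonal_mat D'"
    using diag D E by (auto simp: diagonal_mat_def D'_def)
  note cs = assoc_mult_mat[of _ "Suc n" "Suc n" _ "Suc n" _ "Suc n"]
  have W': "W\<^sup>T \<in> carrier_mat (Suc n) (Suc n)" "P'\<^sup>T \<in> carrier_mat (Suc n) (Suc n)"
    using W P' by auto
  note tr = transpose_mult[OF W P']
  have "(W * P')\<^sup>T * (W * P') = P'\<^sup>T * ((W\<^sup>T * W) * P')"
    unfolding tr using W P' W' by (simp add: cs)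
  hence 1: "(W * P')\<^sup>T * (W * P') = 1\<^sub>m (Suc n)" using P' by (simp add: WW P'P')
  have "(W * P') * D' * (W * P')\<^sup>T = W * (P' * D' * P'\<^sup>T) * W\<^sup>T"
    unfolding tr using W P' W' D' by (simp add: cs)
  also have "\<dots> = (W * W\<^sup>T) * A * (W * W\<^sup>T)"
    unfolding PDP B_def using W W' A by (simp add: cs)
  also have "\<dots> = A" using A by (simp add: WW')
  finally have 2: "A = (W * P') * D' * (W * P')\<^sup>T" ..
  show ?case using 1 2 D' dD W P' by (intro exI[of _ "W * P'"] exI[of _ D']) auto
qed

text \<open>The part of min-max that is needed: if only one eigenvalue exceeded \<open>c\<close>,
  the plane would contain a nonzero combination orthogonal to its eigenvector, and there the form is
  at most \<open>c\<close> times the squared norm. The strict inequality for every nonzero pair of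
  coefficients already forces \<open>u\<close> and \<open>w\<close> to be linearly
  independent.\<close>

lemma two_eigenvalues_greater:
  fixes A :: "real mat"
  assumes A: "A \<in> carrier_mat n n" and sym: "A\<^sup>T = A"
    and uw: "u \<in> carrier_vec n" "w \<in> carrier_vec n"
    and form: "\<And>\<alpha> \<beta>. (\<alpha>, \<beta>) \<noteq> (0, 0) \<Longrightarrow>
       c * ((\<alpha> \<cdot>\<^sub>v u + \<beta> \<cdot>\<^sub>v w) \<bullet> (\<alpha> \<cdot>\<^sub>v u + \<beta> \<cdot>\<^sub>v w))
         < (\<alpha> \<cdot>\<^sub>v u + \<beta> \<cdot>\<^sub>v w) \<bullet> (A *\<^sub>v (\<alpha> \<cdot>\<^sub>v u + \<beta> \<cdot>\<^sub>v w))"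
  shows "size (filter_mset (\<lambda>x. x > c) (proots (char_poly A))) \<ge> 2"
proof (rule ccontr)
  assume neg: "\<not> ?thesis"
  obtain W D where W: "W \<in> carrier_mat n n" and D: "D \<in> carrier_mat n n"
    and WW: "W\<^sup>T * W = 1\<^sub>m n" and diag: "diagonal_mat D" and AW: "A = W * D * W\<^sup>T"
    using real_symmetric_mat_diagonalization[OF A sym] by blast
  have WW': "W * W\<^sup>T = 1\<^sub>m n" using mat_mult_left_right_inverse[OF _ W WW] W by simp
  have "similar_mat_wit A D W (W\<^sup>T)"
    by (rule similar_mat_witI[OF WW' WW AW A D W]) (use W in simp)
  hence "similar_mat A D" unfolding similar_mat_def by blast
  hence "char_poly A = char_poly D" by (rule char_poly_similar)
  also have "\<dots> = (\<Prod>x\<leftarrow>diag_mat D. [:- x, 1:])"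
    by (rule char_poly_upper_triangular[OF D])
      (use diag D in \<open>auto simp: diagonal_mat_def upper_triangular_def\<close>)
  also have "proots \<dots> = mset (diag_mat D)"
  proof -
    have "(\<Prod>x\<leftarrow>xs. [:- x, 1:]) \<noteq> 0 \<and> proots (\<Prod>x\<leftarrow>xs. [:- x, 1:]) = mset xs" for xs :: "real list"
      by (induction xs) (auto simp: proots_mult simp del: mult_pCons_left)
    thus ?thesis by blast
  qed
  also have "\<dots> = image_mset (\<lambda>i. D $$ (i, i)) (mset [0..<n])"
    using D by (simp add: diag_mat_def)
  finally have "size (filter_mset (\<lambda>x. x > c) (proots (char_poly A)))
      = card {i \<in> {0..<n}. D $$ (i, i) > c}"
    by (simp add: filter_mset_image_mset flip: mset_set_upto_eq_mset_upto)
  with neg have card: "card {i \<in> {0..<n}. D $$ (i, i) > c} \<le> 1" by simp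
  \<comment> \<open>\<open>k\<close> is the only index that may carry an eigenvalue above
    \<open>c\<close>. If there is none, 0 is a placeholder, out of range when \<open>n = 0\<close>;
    hence the guard in \<open>yk\<close>.\<close>
  obtain k where k: "\<And>i. i < n \<Longrightarrow> i \<noteq> k \<Longrightarrow> D $$ (i, i) \<le> c"
  proof (cases "\<exists>k<n. D $$ (k, k) > c")
    case True
    then obtain k where k: "k < n" "D $$ (k, k) > c" by blast
    show ?thesis
    proof (rule that[of k], rule ccontr)
      fix i assume "i < n" "i \<noteq> k" "\<not> D $$ (i, i) \<le> c"
      hence "card {i, k} \<le> card {i \<in> {0..<n}. D $$ (i, i) > c}"
        using k by (intro card_mono) auto
      thus False using card \<open>i \<noteq> k\<close> by simp
    qed
  next
    case False
    thus ?thesis using that[of 0] by force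
  qed
  define p where "p = (W\<^sup>T *\<^sub>v u) $ k"
  define q where "q = (W\<^sup>T *\<^sub>v w) $ k"
  \<comment> \<open>One homogeneous linear equation in two unknowns: the combination whose
    coordinate along the eigenvector number \<open>k\<close> vanishes.\<close>
  obtain \<alpha> \<beta> where ab: "(\<alpha>, \<beta>) \<noteq> (0, 0)" "\<alpha> * p + \<beta> * q = 0"
  proof (cases "p = 0")
    case True thus ?thesis using that[of 1 0] by simp
  next
    case False thus ?thesis using that[of q "- p"] by simp
  qed
  define x where "x = \<alpha> \<cdot>\<^sub>v u + \<beta> \<cdot>\<^sub>v w"
  define y where "y = W\<^sup>T *\<^sub>v x"
  have x: "x \<in> carrier_vec n" and y: "y \<in> carrier_vec n" using uw W by (auto simp: x_def y_def)
  have xy: "x = W *\<^sub>v y"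
    using x W by (simp add: y_def WW' flip: assoc_mult_mat_vec[of _ n n _ n])
  have yk: "y $ k = 0" if "k < n"
  proof -
    have "y = \<alpha> \<cdot>\<^sub>v (W\<^sup>T *\<^sub>v u) + \<beta> \<cdot>\<^sub>v (W\<^sup>T *\<^sub>v w)"
      unfolding y_def x_def using uw W
      by (subst mult_add_distrib_mat_vec[of _ n n]) (auto simp: mult_mat_vec)
    thus ?thesis using ab(2) that W by (simp add: p_def q_def)
  qed
  have adj: "(W *\<^sub>v a) \<bullet> b = a \<bullet> (W\<^sup>T *\<^sub>v b)" if "a \<in> carrier_vec n" "b \<in> carrier_vec n" for a b
    using transpose_vec_mult_scalar[OF W that] that W
    by (metis comm_scalar_prod mult_mat_vec_carrier transpose_carrier_mat)
  have xx: "x \<bullet> x = y \<bullet> y"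
    using adj[OF y x] by (simp only: xy[symmetric] y_def[symmetric])
  have Ax: "A *\<^sub>v x = W *\<^sub>v (D *\<^sub>v y)"
    unfolding AW y_def using W D x by (simp add: assoc_mult_mat_vec[of _ n n _ n])
  have "A *\<^sub>v x \<in> carrier_vec n" using A x by simp
  from adj[OF y this] have "x \<bullet> (A *\<^sub>v x) = y \<bullet> (W\<^sup>T *\<^sub>v (A *\<^sub>v x))"
    by (simp only: xy[symmetric])
  also have "W\<^sup>T *\<^sub>v (A *\<^sub>v x) = W\<^sup>T *\<^sub>v (W *\<^sub>v (D *\<^sub>v y))" by (simp only: Ax)
  also have "W\<^sup>T *\<^sub>v (W *\<^sub>v (D *\<^sub>v y)) = D *\<^sub>v y"
    by (subst assoc_mult_mat_vec[symmetric, of _ n n _ n]) (use W D y WW in auto)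
  also have "y \<bullet> (D *\<^sub>v y) = (\<Sum>i<n. y $ i * (D $$ (i, i) * y $ i))"
  proof -
    have "(D *\<^sub>v y) $ i = D $$ (i, i) * y $ i" if i: "i < n" for i
    proof -
      have "(D *\<^sub>v y) $ i = (\<Sum>j<n. D $$ (i, j) * y $ j)"
        using i D y by (simp add: scalar_prod_def atLeast0LessThan)
      also have "\<dots> = (\<Sum>j<n. if j = i then D $$ (i, i) * y $ i else 0)"
        using diag D i by (intro sum.cong) (auto simp: diagonal_mat_def)
      finally show ?thesis using i by simp
    qed
    thus ?thesis using D by (simp add: scalar_prod_def atLeast0LessThan)
  qed
  also have "\<dots> \<le> (\<Sum>i<n. c * (y $ i)\<^sup>2)"
  proof (rule sum_mono)
    fix i assume "i \<in> {..<n}"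
    thus "y $ i * (D $$ (i, i) * y $ i) \<le> c * (y $ i)\<^sup>2"
      using yk k[of i] mult_right_mono[of "D $$ (i, i)" c "y $ i * y $ i"]
      by (cases "i = k") (auto simp: power2_eq_square mult_ac)
  qed
  also have "\<dots> = c * (x \<bullet> x)"
    unfolding xx using y by (simp add: scalar_prod_def atLeast0LessThan sum_distrib_left power2_eq_square)
  finally show False using form[OF ab(1)] by (simp add: x_def)
qed

section \<open>Coverings and their sheets\<close>

definition lift_head :: "('v, 'd) pre_digraph \<Rightarrow> ('d \<Rightarrow> 'd0) \<Rightarrow> 'v \<Rightarrow> 'd0 \<Rightarrow> 'v" where
  "lift_head G pd w d = head G (the_inv_into (out_arcs G w) pd d)"

text \<open>Monodromy data: stepping along \<open>d\<close> is a bijection from the fibre over the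
  tail of \<open>d\<close> to the fibre over its head, with inverse the step along
  \<open>r0 d\<close>. One format serves the finite covers and the tree, and it keeps the arcs of
  the cover out of the later arguments.\<close>

locale sheets =
  fixes G0 :: "('v0, 'd0) pre_digraph" and r0 :: "'d0 \<Rightarrow> 'd0"
    and V :: "'v set" and p :: "'v \<Rightarrow> 'v0" and s :: "'v \<Rightarrow> 'd0 \<Rightarrow> 'v"
  assumes base: "bidirected_digraph G0 r0"
    and proj_in: "w \<in> V \<Longrightarrow> p w \<in> verts G0"
    and step_in: "w \<in> V \<Longrightarrow> d \<in> out_arcs G0 (p w) \<Longrightarrow> s w d \<in> V"
    and proj_step: "w \<in> V \<Longrightarrow> d \<in> out_arcs G0 (p w) \<Longrightarrow> p (s w d) = head G0 d"
    and step_back: "w \<in> V \<Longrightarrow> d \<in> out_arcs G0 (p w) \<Longrightarrow> s (s w d) (r0 d) = w"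
begin

sublocale base: bidirected_digraph G0 r0 by (rule base)

lemma rev_out: "w \<in> V \<Longrightarrow> d \<in> out_arcs G0 (p w) \<Longrightarrow> r0 d \<in> out_arcs G0 (p (s w d))"
  by (simp add: proj_step)

lemma step_inj:
  assumes "w \<in> V" "w' \<in> V" "p w = p w'" "d \<in> out_arcs G0 (p w)" "s w d = s w' d"
  shows "w = w'"
  using step_back assms by metis

end

lemma graph_covering_lift_head:
  assumes "graph_covering G r G0 r0 pv pd" and "e \<in> arcs G"
  shows "lift_head G pd (tail G e) (pd e) = head G e"
proof -
  interpret bidirected_digraph G r using assms by (simp add: graph_covering_def)
  have "inj_on pd (out_arcs G (tail G e))"
    using assms by (auto simp: graph_covering_def bij_betw_def)
  thus ?thesis using assms(2) by (simp add: lift_head_def the_inv_into_f_f)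
qed

lemma graph_covering_lift_arc:
  assumes "graph_covering G r G0 r0 pv pd" and "w \<in> verts G" and "d \<in> out_arcs G0 (pv w)"
  obtains e where "e \<in> arcs G" "tail G e = w" "pd e = d" "lift_head G pd w d = head G e"
proof -
  have "d \<in> pd ` out_arcs G w"
    using assms by (auto simp: graph_covering_def bij_betw_def)
  thus ?thesis using that graph_covering_lift_head[OF assms(1)] by force
qed

lemma graph_covering_sheets:
  assumes cov: "graph_covering G r G0 r0 pv pd"
  shows "sheets G0 r0 (verts G) pv (lift_head G pd)"
proof -
  interpret G: bidirected_digraph G r using cov by (simp add: graph_covering_def)
  interpret G0: bidirected_digraph G0 r0 using cov by (simp add: graph_covering_def)
  show ?thesis
  proof
    fix w assume w: "w \<in> verts G"
    show "pv w \<in> verts G0" using w cov by (auto simp: graph_covering_def)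
    fix d assume d: "d \<in> out_arcs G0 (pv w)"
    obtain e where e: "e \<in> arcs G" "tail G e = w" "pd e = d" "lift_head G pd w d = head G e"
      using graph_covering_lift_arc[OF cov w d] .
    show "lift_head G pd w d \<in> verts G" using e by simp
    \<comment> \<open>The reverse of a lift of \<open>d\<close> is the lift of \<open>r0 d\<close>
      that starts at the other end; this gives \<open>step_back\<close>.\<close>
    have re: "pd (r e) = r0 d" "r e \<in> arcs G" "tail G (r e) = head G e" "head G (r e) = w"
      using e cov by (auto simp: graph_covering_def)
    have "pv (head G e) = tail G0 (pd (r e))"
      using cov re by (auto simp: graph_covering_def)
    thus "pv (lift_head G pd w d) = head G0 d" using d re e by simp
    show "lift_head G pd (lift_head G pd w d) (r0 d) = w"
      using graph_covering_lift_head[OF cov re(2)] re e by simp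
  qed
qed

lemma (in bidirected_digraph) awalk_rev:
  "awalk u q v \<Longrightarrow> awalk v (map arev (rev q)) u"
proof (induction q arbitrary: u)
  case Nil thus ?case by (auto simp: awalk_Nil_iff)
next
  case (Cons e q)
  hence e: "e \<in> arcs G" "u = tail G e" "awalk (head G e) q v" by (auto simp: awalk_Cons_iff)
  have "awalk (head G e) [arev e] u" using e by (simp add: awalk_simps)
  thus ?case using awalk_appendI[OF Cons.IH[OF e(3)]] by simp
qed

section \<open>Covering maps from the tree, built by lifting walks\<close>

locale tree_sheets = sheets G0 r0 V p s
  for G0 :: "('v0, 'd0) pre_digraph" and r0 :: "'d0 \<Rightarrow> 'd0"
    and V :: "'v set" and p :: "'v \<Rightarrow> 'v0" and s :: "'v \<Rightarrow> 'd0 \<Rightarrow> 'v" +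
  fixes T :: "('t, 'e) pre_digraph" and rT :: "'e \<Rightarrow> 'e" and pvT :: "'t \<Rightarrow> 'v0" and pdT :: "'e \<Rightarrow> 'd0"
  assumes univ: "universal_cover T rT G0 r0 pvT pdT"
begin

lemma cover: "graph_covering T rT G0 r0 pvT pdT"
  using univ by (simp add: universal_cover_def)

sublocale T: bidirected_digraph T rT
  using cover by (simp add: graph_covering_def)

sublocale T_sheets: sheets G0 r0 "verts T" pvT "lift_head T pdT"
  using cover by (rule graph_covering_sheets)

text \<open>The endpoint of the walk in the cover that starts at \<open>x\<close> and has the same
  projection to the base as the tree walk \<open>q\<close>.\<close>

definition transport :: "'v \<Rightarrow> 'e list \<Rightarrow> 'v" where
  "transport x q = foldl s x (map pdT q)"

lemma transport_simps [simp]: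
  "transport x [] = x"
  "transport x (e # q) = transport (s x (pdT e)) q"
  "transport x (q @ q') = transport (transport x q) q'"
  by (simp_all add: transport_def)

lemma arcD:
  assumes "e \<in> arcs T"
  shows "pdT e \<in> out_arcs G0 (pvT (tail T e))" "head G0 (pdT e) = pvT (head T e)"
    "pdT (rT e) = r0 (pdT e)"
proof -
  show 1: "pdT e \<in> out_arcs G0 (pvT (tail T e))" "pdT (rT e) = r0 (pdT e)"
    using cover assms by (auto simp: graph_covering_def)
  show "head G0 (pdT e) = pvT (head T e)"
    using T_sheets.proj_step[of "tail T e" "pdT e"] 1 assms graph_covering_lift_head[OF cover assms]
    by simp
qed

lemma transport_in:
  "T.awalk u q v \<Longrightarrow> x \<in> V \<Longrightarrow> p x = pvT u \<Longrightarrow> transport x q \<in> V \<and> p (transport x q) = pvT v"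
proof (induction q arbitrary: u x)
  case Nil thus ?case by (simp add: T.awalk_Nil_iff)
next
  case (Cons e q)
  hence e: "e \<in> arcs T" "u = tail T e" "T.awalk (head T e) q v" by (auto simp: T.awalk_Cons_iff)
  show ?case
    using Cons.IH[OF e(3), of "s x (pdT e)"] Cons.prems e arcD[OF e(1)] step_in[of x "pdT e"] proj_step[of x "pdT e"]
    by simp
qed

lemma transport_rev:
  "T.awalk u q v \<Longrightarrow> x \<in> V \<Longrightarrow> p x = pvT u \<Longrightarrow> transport (transport x q) (map rT (rev q)) = x"
proof (induction q arbitrary: u x)
  case Nil thus ?case by simp
next
  case (Cons e q)
  hence e: "e \<in> arcs T" "u = tail T e" "T.awalk (head T e) q v" by (auto simp: T.awalk_Cons_iff)
  show ?case
    using Cons.IH[OF e(3), of "s x (pdT e)"] Cons.prems e arcD[OF e(1)] step_in[of x "pdT e"]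
      proj_step[of x "pdT e"] step_back[of x "pdT e"]
    by simp
qed

text \<open>Monodromy is trivial on a simply connected graph. A nonempty closed walk in a tree must
  backtrack somewhere; by \<open>step_back\<close> the two backtracking arcs do not affect the
  transport, so they can be deleted and induction on the length applies.\<close>

lemma transport_closed:
  "T.awalk u q u \<Longrightarrow> x \<in> V \<Longrightarrow> p x = pvT u \<Longrightarrow> transport x q = x"
proof (induction "length q" arbitrary: q rule: less_induct)
  case less
  show ?case
  proof (cases "q = []")
    case False
    with less.prems(1) univ have "\<not> reduced_walk rT q"
      by (auto simp: universal_cover_def tree_def)
    then obtain i where i: "Suc i < length q" "q ! Suc i = rT (q ! i)"
      by (auto simp: reduced_walk_def)
    define q1 where "q1 = take i q"
    define q2 where "q2 = drop (Suc (Suc i)) q"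
    define e where "e = q ! i"
    have q: "q = q1 @ [e, rT e] @ q2"
      using i by (simp add: q1_def q2_def e_def Cons_nth_drop_Suc flip: i(2))
    have e: "e \<in> arcs T" and w: "T.awalk u q1 (tail T e)" "T.awalk (tail T e) q2 u"
      using less.prems(1) by (auto simp: q T.awalk_Cons_iff)
    have "T.awalk u (q1 @ q2) u" using w by (rule T.awalk_appendI)
    hence "transport x (q1 @ q2) = x" using less.hyps[of "q1 @ q2"] less.prems q by simp
    moreover have "s (s (transport x q1) (pdT e)) (r0 (pdT e)) = transport x q1"
      using transport_in[OF w(1) less.prems(2,3)] arcD[OF e] by (intro step_back) auto
    ultimately show ?thesis using arcD[OF e] by (simp add: q)
  qed simp
qed

text \<open>The walk \<open>q\<close> followed by the reverse of \<open>q'\<close> is closed, so it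
  returns \<open>x\<close> to itself; transporting once more along \<open>q'\<close> undoes the
  reversed part.\<close>

lemma transport_unique:
  assumes q: "T.awalk u q v" and q': "T.awalk u q' v" and x: "x \<in> V" "p x = pvT u"
  shows "transport x q = transport x q'"
proof -
  have "transport x (q @ map rT (rev q')) = x"
    using T.awalk_appendI[OF q T.awalk_rev[OF q']] x by (rule transport_closed)
  moreover have "transport (transport (transport x q) (map rT (rev q'))) q' = transport x q"
    using transport_rev[OF T.awalk_rev[OF q'], of "transport x q"] transport_in[OF q x]
    by (simp add: rev_map o_def)
  ultimately show ?thesis by simp
qed

definition path :: "'t \<Rightarrow> 't \<Rightarrow> 'e list" where
  "path t0 t = (SOME q. T.awalk t0 q t)"

text \<open>The vertex part of the covering map that sends \<open>t0\<close> to \<open>x\<close>.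
  The choice made by \<open>path\<close> is harmless because of
  \<open>transport_unique\<close>.\<close>

definition sheet_map :: "'t \<Rightarrow> 'v \<Rightarrow> 't \<Rightarrow> 'v" where
  "sheet_map t0 x t = transport x (path t0 t)"

lemma awalk_path:
  assumes "t0 \<in> verts T" "t \<in> verts T"
  shows "T.awalk t0 (path t0 t) t"
proof -
  have "\<exists>q. T.awalk t0 q t"
    using univ assms unfolding universal_cover_def tree_def strongly_connected_def
    by (simp flip: T.reachable_awalk)
  thus ?thesis unfolding path_def by (rule someI_ex)
qed

lemma sheet_map_in:
  assumes "t0 \<in> verts T" "t \<in> verts T" "x \<in> V" "p x = pvT t0"
  shows "sheet_map t0 x t \<in> V \<and> p (sheet_map t0 x t) = pvT t"
  unfolding sheet_map_def using transport_in[OF awalk_path] assms by blast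

text \<open>The chosen path to \<open>t\<close>, extended by the lift of \<open>d\<close>, competes
  with the chosen path to the neighbour of \<open>t\<close>; both transport \<open>x\<close> to the
  same vertex.\<close>

lemma sheet_map_step:
  assumes t: "t0 \<in> verts T" "t \<in> verts T" and x: "x \<in> V" "p x = pvT t0"
    and d: "d \<in> out_arcs G0 (pvT t)"
  shows "sheet_map t0 x (lift_head T pdT t d) = s (sheet_map t0 x t) d"
proof -
  obtain e where e: "e \<in> arcs T" "tail T e = t" "pdT e = d" "lift_head T pdT t d = head T e"
    using graph_covering_lift_arc[OF cover t(2) d] .
  have "T.awalk t [e] (head T e)" using e by (auto simp: T.awalk_simps)
  with awalk_path[OF t] have "T.awalk t0 (path t0 t @ [e]) (head T e)" by (rule T.awalk_appendI)
  from transport_unique[OF awalk_path[OF t(1)] this x]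
  show ?thesis using e by (simp add: sheet_map_def)
qed

text \<open>Here the tree vertex is fixed and the base point varies; transport along the reversed
  path is the inverse. It makes all fibres of the cover equally large, and it drives the counting in
  \<open>separated_sheets\<close>.\<close>

lemma bij_betw_sheet_map:
  assumes t: "t0 \<in> verts T" "t \<in> verts T"
  shows "bij_betw (\<lambda>x. sheet_map t0 x t) {x \<in> V. p x = pvT t0} {y \<in> V. p y = pvT t}"
proof -
  note Q = awalk_path[OF t]
  note R = T.awalk_rev[OF Q]
  show ?thesis
    unfolding sheet_map_def
  proof (rule bij_betw_byWitness[of _ "\<lambda>y. transport y (map rT (rev (path t0 t)))"])
    show "\<forall>y\<in>{y \<in> V. p y = pvT t}. transport (transport y (map rT (rev (path t0 t)))) (path t0 t) = y"
      using transport_rev[OF R] by (simp add: rev_map o_def)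
  qed (use transport_rev[OF Q] transport_in[OF Q] transport_in[OF R] in auto)
qed

end

section \<open>Quadratic forms and push-forward\<close>

text \<open>The lifted Jacobi operator as a sum over arcs of the base. A loop is two arcs, so its
  factor 2 disappears. Values in any real vector space are allowed because the operator acts on
  complex functions on the tree and on real functions on the finite covers.\<close>

definition sheet_op ::
  "('v0, 'd0) pre_digraph \<Rightarrow> ('d0 \<Rightarrow> real) \<Rightarrow> ('v0 \<Rightarrow> real) \<Rightarrow> ('v \<Rightarrow> 'v0) \<Rightarrow> ('v \<Rightarrow> 'd0 \<Rightarrow> 'v) \<Rightarrow>
   ('v \<Rightarrow> 'a::real_vector) \<Rightarrow> 'v \<Rightarrow> 'a" where
  "sheet_op G0 \<alpha> \<beta> p s f v = \<beta> (p v) *\<^sub>R f v + (\<Sum>d\<in>out_arcs G0 (p v). \<alpha> d *\<^sub>R f (s v d))"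

lemma sum_L2_set_fibres:
  assumes "finite F"
  shows "(\<Sum>w\<in>\<phi> ` F. (L2_set f {t\<in>F. \<phi> t = w})\<^sup>2) = (\<Sum>t\<in>F. (f t)\<^sup>2)"
proof -
  have "(\<Sum>w\<in>\<phi> ` F. (L2_set f {t\<in>F. \<phi> t = w})\<^sup>2) = (\<Sum>w\<in>\<phi> ` F. \<Sum>t | t \<in> F \<and> \<phi> t = w. (f t)\<^sup>2)"
    by (simp add: L2_set_def sum_nonneg)
  also have "\<dots> = (\<Sum>t\<in>F. (f t)\<^sup>2)" using assms by (intro sum.group) auto
  finally show ?thesis .
qed

lemma sum_image_le_support:
  fixes g :: "'b \<Rightarrow> real"
  assumes "finite S" "finite B" "inj_on h S" "\<And>x. g x \<ge> 0"
    and "\<And>x. x \<in> S \<Longrightarrow> g (h x) \<noteq> 0 \<Longrightarrow> h x \<in> B"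
  shows "(\<Sum>x\<in>S. g (h x)) \<le> sum g B"
proof -
  have "(\<Sum>x\<in>S. g (h x)) = sum g (h ` S)" using assms(3) by (simp add: sum.reindex)
  also have "\<dots> = sum g (h ` S \<inter> B)"
    using assms by (intro sum.mono_neutral_right) auto
  also have "\<dots> \<le> sum g B" using assms by (intro sum_mono2) auto
  finally show ?thesis .
qed

text \<open>
  The \<open>\<ell>\<^sup>2\<close> push-forward keeps the norm, and by the Cauchy-Schwarz inequality it does not
  decrease the contribution of any arc to the quadratic form. This replaces test functions
  supported on embedded balls.
\<close>

lemma pushforward_form_ge:
  fixes f :: "'t \<Rightarrow> complex"
  assumes G: "sheets G0 r0 V p s" and T: "sheets G0 r0 V' p' s'" and fin: "fin_digraph G0"
    and \<alpha>: "\<And>d. d \<in> arcs G0 \<Longrightarrow> \<alpha> d \<ge> 0"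
    and \<phi>: "\<And>t. t \<in> V' \<Longrightarrow> \<phi> t \<in> V \<and> p (\<phi> t) = p' t"
      "\<And>t d. t \<in> V' \<Longrightarrow> d \<in> out_arcs G0 (p' t) \<Longrightarrow> \<phi> (s' t d) = s (\<phi> t) d"
    and F: "finite F" "F \<subseteq> V'" and supp: "\<And>t. t \<notin> F \<Longrightarrow> f t = 0"
    and g: "\<And>w. g w = L2_set (\<lambda>t. cmod (f t)) {t\<in>F. \<phi> t = w}"
  shows "(\<Sum>t\<in>F. Re (cnj (f t) * sheet_op G0 \<alpha> \<beta> p' s' f t)) \<le> (\<Sum>w\<in>\<phi> ` F. g w * sheet_op G0 \<alpha> \<beta> p s g w)"
proof -
  interpret T: sheets G0 r0 V' p' s' by (rule T)
  interpret fin_digraph G0 by (rule fin)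
  have "(\<Sum>t | t \<in> F \<and> \<phi> t = w. Re (cnj (f t) * sheet_op G0 \<alpha> \<beta> p' s' f t))
      \<le> g w * sheet_op G0 \<alpha> \<beta> p s g w" if w: "w \<in> \<phi> ` F" for w
  proof -
    define S where "S = {t\<in>F. \<phi> t = w}"
    have S: "finite S" "S \<subseteq> V'" using F by (auto simp: S_def)
    have p': "p' t = p w" if "t \<in> S" for t using that S \<phi>(1) by (auto simp: S_def)
    \<comment> \<open>For fixed \<open>d\<close>, the step along \<open>d\<close> sends the fibre
      \<open>S\<close> over \<open>w\<close> injectively into the fibre over \<open>s w d\<close>,
      apart from points outside \<open>F\<close>, where \<open>f\<close> vanishes. Hence the shifted
      function on \<open>S\<close> has norm at most \<open>g (s w d)\<close>.\<close>
    have arc: "(\<Sum>t\<in>S. cmod (f t) * cmod (f (s' t d))) \<le> g w * g (s w d)" if d: "d \<in> out_arcs G0 (p w)" for d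
    proof -
      have "(\<Sum>t\<in>S. (cmod (f (s' t d)))\<^sup>2) \<le> (\<Sum>u | u \<in> F \<and> \<phi> u = s w d. (cmod (f u))\<^sup>2)"
      proof (rule sum_image_le_support)
        show "inj_on (\<lambda>t. s' t d) S"
          by (rule inj_onI, rule T.step_inj[of _ _ d]) (use S(2) p' d in auto)
        fix t assume t: "t \<in> S" and "(cmod (f (s' t d)))\<^sup>2 \<noteq> 0"
        hence "s' t d \<in> F" using supp by force
        moreover have "\<phi> (s' t d) = s w d"
          using \<phi>(2)[of t d] t S(2) p'[OF t] d by (auto simp: S_def)
        ultimately show "s' t d \<in> {u \<in> F. \<phi> u = s w d}" by simp
      qed (use S F in auto)
      hence "L2_set (\<lambda>t. cmod (f (s' t d))) S \<le> g (s w d)"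
        unfolding g L2_set_def by simp
      moreover have "(\<Sum>t\<in>S. cmod (f t) * cmod (f (s' t d)))
          \<le> L2_set (\<lambda>t. cmod (f t)) S * L2_set (\<lambda>t. cmod (f (s' t d))) S"
        using L2_set_mult_ineq[of "\<lambda>t. cmod (f t)" "\<lambda>t. cmod (f (s' t d))" S] by simp
      ultimately show ?thesis
        using mult_left_mono[of "L2_set (\<lambda>t. cmod (f (s' t d))) S" "g (s w d)" "g w"]
        by (simp add: g[of w] S_def)
    qed
    have "(\<Sum>t\<in>S. Re (cnj (f t) * sheet_op G0 \<alpha> \<beta> p' s' f t))
        \<le> (\<Sum>t\<in>S. \<beta> (p w) * (cmod (f t))\<^sup>2
             + (\<Sum>d\<in>out_arcs G0 (p w). \<alpha> d * (cmod (f t) * cmod (f (s' t d)))))"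
    proof (rule sum_mono)
      fix t assume t: "t \<in> S"
      have "cnj (f t) * sheet_op G0 \<alpha> \<beta> p' s' f t
        = of_real (\<beta> (p w)) * of_real ((cmod (f t))\<^sup>2)
          + (\<Sum>d\<in>out_arcs G0 (p w). of_real (\<alpha> d) * (cnj (f t) * f (s' t d)))"
        unfolding complex_norm_square sheet_op_def p'[OF t]
        by (simp add: scaleR_conv_of_real sum_distrib_left algebra_simps)
      moreover have "Re (of_real B * of_real N + (\<Sum>d\<in>D. of_real (\<alpha> d) * X d)) = B * N + (\<Sum>d\<in>D. \<alpha> d * Re (X d))"
        for B N D and X :: "_ \<Rightarrow> complex"
        by (simp add: Re_sum)
      ultimately have "Re (cnj (f t) * sheet_op G0 \<alpha> \<beta> p' s' f t)
        = \<beta> (p w) * (cmod (f t))\<^sup>2 + (\<Sum>d\<in>out_arcs G0 (p w). \<alpha> d * Re (cnj (f t) * f (s' t d)))"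
        by (simp only:)
      also have "\<dots> \<le> \<beta> (p w) * (cmod (f t))\<^sup>2
             + (\<Sum>d\<in>out_arcs G0 (p w). \<alpha> d * (cmod (f t) * cmod (f (s' t d))))"
      proof (intro add_left_mono sum_mono mult_left_mono)
        fix d assume "d \<in> out_arcs G0 (p w)"
        thus "0 \<le> \<alpha> d" using \<alpha> by simp
        show "Re (cnj (f t) * f (s' t d)) \<le> cmod (f t) * cmod (f (s' t d))"
          using complex_Re_le_cmod[of "cnj (f t) * f (s' t d)"] by (simp add: norm_mult)
      qed
      finally show "Re (cnj (f t) * sheet_op G0 \<alpha> \<beta> p' s' f t) \<le> \<dots>" .
    qed
    also have "\<dots> = \<beta> (p w) * (\<Sum>t\<in>S. (cmod (f t))\<^sup>2)
        + (\<Sum>d\<in>out_arcs G0 (p w). \<alpha> d * (\<Sum>t\<in>S. cmod (f t) * cmod (f (s' t d))))"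
      by (simp add: sum.distrib sum_distrib_left sum.swap[of _ _ S])
    also have "(\<Sum>t\<in>S. (cmod (f t))\<^sup>2) = (g w)\<^sup>2"
      by (simp add: g L2_set_def S_def sum_nonneg)
    also have "\<beta> (p w) * (g w)\<^sup>2 + (\<Sum>d\<in>out_arcs G0 (p w). \<alpha> d * (\<Sum>t\<in>S. cmod (f t) * cmod (f (s' t d))))
        \<le> \<beta> (p w) * (g w)\<^sup>2 + (\<Sum>d\<in>out_arcs G0 (p w). \<alpha> d * (g w * g (s w d)))"
      using arc \<alpha> by (intro add_left_mono sum_mono mult_left_mono) auto
    also have "\<dots> = g w * sheet_op G0 \<alpha> \<beta> p s g w"
      by (simp add: sheet_op_def sum_distrib_left algebra_simps power2_eq_square)
    finally show ?thesis by (simp add: S_def)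
  qed
  hence "(\<Sum>w\<in>\<phi> ` F. \<Sum>t | t \<in> F \<and> \<phi> t = w. Re (cnj (f t) * sheet_op G0 \<alpha> \<beta> p' s' f t))
      \<le> (\<Sum>w\<in>\<phi> ` F. g w * sheet_op G0 \<alpha> \<beta> p s g w)"
    by (rule sum_mono)
  thus ?thesis using F(1) by (subst (asm) sum.group) auto
qed

text \<open>The constant depends on the base only: 2 \<open>B\<close> comes from the diagonal, and
  the other summand from Cauchy-Schwarz over the arcs at a vertex together with the fact that, for
  each arc of the base, the shift along it is injective and so does not increase the norm. Only
  finite sums occur, so that the bound is available before any summability question.\<close>

lemma sheet_op_bounded:
  assumes sh: "sheets G0 r0 V p s" and fin: "fin_digraph G0"
  obtains M where "M \<ge> 0"
    "\<And>(f :: 'v \<Rightarrow> complex) F X. finite F \<Longrightarrow> finite X \<Longrightarrow> X \<subseteq> V \<Longrightarrow>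
       (\<And>t. t \<notin> F \<Longrightarrow> f t = 0) \<Longrightarrow>
       (\<Sum>v\<in>X. (cmod (sheet_op G0 \<alpha> \<beta> p s f v))\<^sup>2) \<le> M * (\<Sum>t\<in>F. (cmod (f t))\<^sup>2)"
proof -
  interpret sheets G0 r0 V p s by (rule sh)
  interpret fin_digraph G0 by (rule fin)
  define B where "B = (\<Sum>u\<in>verts G0. (\<beta> u)\<^sup>2)"
  define A where "A = (\<Sum>d\<in>arcs G0. (\<alpha> d)\<^sup>2)"
  have AB: "A \<ge> 0" "B \<ge> 0" by (simp_all add: A_def B_def sum_nonneg)
  show ?thesis
  proof (rule that[of "2 * B + 2 * (A * card (arcs G0))"])
    show "0 \<le> 2 * B + 2 * (A * card (arcs G0))" using AB by simp
    fix f :: "'v \<Rightarrow> complex" and F X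
    assume F: "finite F" and X: "finite X" "X \<subseteq> V"
      and supp: "\<And>t. t \<notin> F \<Longrightarrow> f t = 0"
    have "(cmod (sheet_op G0 \<alpha> \<beta> p s f v))\<^sup>2
        \<le> 2 * (B * (cmod (f v))\<^sup>2) + 2 * (A * (\<Sum>d\<in>out_arcs G0 (p v). (cmod (f (s v d)))\<^sup>2))"
      if v: "v \<in> X" for v
    proof -
      define x where "x = \<bar>\<beta> (p v)\<bar> * cmod (f v)"
      define y where "y = (\<Sum>d\<in>out_arcs G0 (p v). \<bar>\<alpha> d\<bar> * cmod (f (s v d)))"
      have "cmod (sheet_op G0 \<alpha> \<beta> p s f v) \<le> x + y"
        unfolding sheet_op_def x_def y_def
        by (rule order_trans[OF norm_triangle_ineq], intro add_mono sum_norm_le) auto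
      hence "(cmod (sheet_op G0 \<alpha> \<beta> p s f v))\<^sup>2 \<le> (x + y)\<^sup>2" by (rule power_mono) simp
      also have "\<dots> \<le> 2 * x\<^sup>2 + 2 * y\<^sup>2" using sum_squares_bound[of x y] by (simp add: power2_sum)
      also have "x\<^sup>2 \<le> B * (cmod (f v))\<^sup>2"
      proof -
        have "(\<beta> (p v))\<^sup>2 \<le> B" unfolding B_def
          using proj_in[of v] v X by (intro member_le_sum) auto
        thus ?thesis by (simp add: x_def power_mult_distrib mult_right_mono)
      qed
      also have "y\<^sup>2 \<le> A * (\<Sum>d\<in>out_arcs G0 (p v). (cmod (f (s v d)))\<^sup>2)"
      proof -
        have "y\<^sup>2 \<le> (\<Sum>d\<in>out_arcs G0 (p v). \<bar>\<alpha> d\<bar>\<^sup>2) * (\<Sum>d\<in>out_arcs G0 (p v). (cmod (f (s v d)))\<^sup>2)"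
          using power_mono[OF L2_set_mult_ineq[of \<alpha> "\<lambda>d. cmod (f (s v d))" "out_arcs G0 (p v)"], of 2]
          by (simp add: y_def L2_set_def power_mult_distrib sum_nonneg)
        also have "\<dots> \<le> A * (\<Sum>d\<in>out_arcs G0 (p v). (cmod (f (s v d)))\<^sup>2)"
          unfolding A_def by (intro mult_right_mono) (auto intro!: sum_mono2 sum_nonneg)
        finally show ?thesis .
      qed
      finally show ?thesis by simp
    qed
    hence "(\<Sum>v\<in>X. (cmod (sheet_op G0 \<alpha> \<beta> p s f v))\<^sup>2)
        \<le> (\<Sum>v\<in>X. 2 * (B * (cmod (f v))\<^sup>2) + 2 * (A * (\<Sum>d\<in>out_arcs G0 (p v). (cmod (f (s v d)))\<^sup>2)))"
      by (rule sum_mono)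
    also have "\<dots> = 2 * (B * (\<Sum>v\<in>X. (cmod (f v))\<^sup>2))
        + 2 * (A * (\<Sum>v\<in>X. \<Sum>d\<in>out_arcs G0 (p v). (cmod (f (s v d)))\<^sup>2))"
      by (simp add: sum.distrib sum_distrib_left)
    also have "\<dots> \<le> 2 * (B * (\<Sum>t\<in>F. (cmod (f t))\<^sup>2)) + 2 * (A * (card (arcs G0) * (\<Sum>t\<in>F. (cmod (f t))\<^sup>2)))"
    proof (intro add_mono mult_left_mono)
      show "(\<Sum>v\<in>X. (cmod (f v))\<^sup>2) \<le> (\<Sum>t\<in>F. (cmod (f t))\<^sup>2)"
        by (rule sum_image_le_support[of _ _ id, simplified]) (use X F supp in auto)
      have "(\<Sum>v\<in>X. \<Sum>d\<in>out_arcs G0 (p v). (cmod (f (s v d)))\<^sup>2)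
          = (\<Sum>v\<in>X. \<Sum>d | d \<in> arcs G0 \<and> tail G0 d = p v. (cmod (f (s v d)))\<^sup>2)"
        by (simp add: out_arcs_def)
      \<comment> \<open>Exchanging the sums puts the arc outside, and for a fixed arc each value of
        \<open>f\<close> is met at most once.\<close>
      also have "\<dots> = (\<Sum>d\<in>arcs G0. \<Sum>v | v \<in> X \<and> tail G0 d = p v. (cmod (f (s v d)))\<^sup>2)"
        using X by (intro sum.swap_restrict) auto
      also have "\<dots> \<le> (\<Sum>d\<in>arcs G0. \<Sum>t\<in>F. (cmod (f t))\<^sup>2)"
      proof (rule sum_mono)
        fix d assume d: "d \<in> arcs G0"
        show "(\<Sum>v | v \<in> X \<and> tail G0 d = p v. (cmod (f (s v d)))\<^sup>2) \<le> (\<Sum>t\<in>F. (cmod (f t))\<^sup>2)"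
        proof (rule sum_image_le_support)
          show "inj_on (\<lambda>v. s v d) {v \<in> X. tail G0 d = p v}"
            by (rule inj_onI, rule step_inj[of _ _ d]) (use X d in auto)
        qed (use X F supp in force)+
      qed
      finally show "(\<Sum>v\<in>X. \<Sum>d\<in>out_arcs G0 (p v). (cmod (f (s v d)))\<^sup>2)
          \<le> card (arcs G0) * (\<Sum>t\<in>F. (cmod (f t))\<^sup>2)" by simp
    qed (use AB in auto)
    finally show "(\<Sum>v\<in>X. (cmod (sheet_op G0 \<alpha> \<beta> p s f v))\<^sup>2)
        \<le> (2 * B + 2 * (A * card (arcs G0))) * (\<Sum>t\<in>F. (cmod (f t))\<^sup>2)"
      by (simp add: algebra_simps)
  qed
qed

section \<open>Jacobi matrices\<close>

text \<open>Between distinct vertices an edge has exactly one orientation that leaves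
  \<open>v\<close>.\<close>

lemma (in bidirected_digraph) sum_edges_between_distinct:
  fixes g :: "'b set \<Rightarrow> real"
  assumes "v \<noteq> w"
  shows "(\<Sum>e\<in>edges_between G arev v w. g e) = (\<Sum>d | d \<in> out_arcs G v \<and> head G d = w. g {d, arev d})"
proof -
  have "edges_between G arev v w = (\<lambda>d. {d, arev d}) ` {d. d \<in> out_arcs G v \<and> head G d = w}"
    by (auto simp: edges_between_def)
  moreover have "inj_on (\<lambda>d. {d, arev d}) {d. d \<in> out_arcs G v \<and> head G d = w}"
    using assms by (auto simp: inj_on_def doubleton_eq_iff)
  ultimately show ?thesis by (simp add: sum.reindex)
qed

text \<open>Both orientations of a loop leave \<open>v\<close>, and they are different arcs, so the
  sum over arcs counts each loop twice. This matches the factor 2 in \<open>jacobi\<close> and lets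
  the diagonal and off-diagonal entries be treated by one formula.\<close>

lemma (in bidirected_digraph) sum_edges_between_loops:
  fixes g :: "'b set \<Rightarrow> real"
  assumes fin: "finite (out_arcs G v)"
  shows "2 * (\<Sum>e\<in>edges_between G arev v v. g e) = (\<Sum>d | d \<in> out_arcs G v \<and> head G d = v. g {d, arev d})"
proof -
  let ?L = "{d. d \<in> out_arcs G v \<and> head G d = v}"
  have E: "edges_between G arev v v = (\<lambda>d. {d, arev d}) ` ?L"
    by (auto simp: edges_between_def)
  have L: "finite ?L" by (rule finite_subset[OF _ fin]) auto
  have "(\<Sum>d\<in>?L. g {d, arev d}) = (\<Sum>e\<in>(\<lambda>d. {d, arev d}) ` ?L. \<Sum>d | d \<in> ?L \<and> {d, arev d} = e. g {d, arev d})"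
    using L by (rule sum.image_gen)
  also have "\<dots> = (\<Sum>e\<in>(\<lambda>d. {d, arev d}) ` ?L. 2 * g e)"
  proof (rule sum.cong)
    fix e assume "e \<in> (\<lambda>d. {d, arev d}) ` ?L"
    then obtain d0 where d0: "d0 \<in> ?L" "e = {d0, arev d0}" by blast
    have "{d. d \<in> ?L \<and> {d, arev d} = e} = {d0, arev d0}"
      using d0 by (auto simp: doubleton_eq_iff)
    moreover have "arev d0 \<noteq> d0" using d0 arev_neq by simp
    ultimately have "card {d. d \<in> ?L \<and> {d, arev d} = e} = 2" by simp
    moreover have "(\<Sum>d | d \<in> ?L \<and> {d, arev d} = e. g {d, arev d}) = (\<Sum>d | d \<in> ?L \<and> {d, arev d} = e. g e)"
      by (rule sum.cong) auto
    ultimately show "(\<Sum>d | d \<in> ?L \<and> {d, arev d} = e. g {d, arev d}) = 2 * g e" by simp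
  qed simp
  finally show ?thesis by (simp add: E sum_distrib_left)
qed

lemma graph_covering_finite_out_arcs:
  assumes cov: "graph_covering G r G0 r0 pv pd" and fin: "fin_digraph G0" and v: "v \<in> verts G"
  shows "finite (out_arcs G v)"
proof -
  interpret fin_digraph G0 by (rule fin)
  have "bij_betw pd (out_arcs G v) (out_arcs G0 (pv v))" using cov v by (simp add: graph_covering_def)
  thus ?thesis using bij_betw_finite by blast
qed

lemma jacobi_lift_eq:
  assumes cov: "graph_covering G r G0 r0 pv pd" and fin: "fin_digraph G0" and v: "v \<in> verts G"
  shows "jacobi_lift G r pv pd a b v w =
    (if v = w then b (pv v) else 0) + (\<Sum>d | d \<in> out_arcs G v \<and> head G d = w. a {pd d, r0 (pd d)})"
proof -
  interpret bidirected_digraph G r using cov by (simp add: graph_covering_def)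
  have "(\<Sum>d | d \<in> out_arcs G v \<and> head G d = w. a (pd ` {d, r d}))
      = (\<Sum>d | d \<in> out_arcs G v \<and> head G d = w. a {pd d, r0 (pd d)})"
    using cov by (intro sum.cong) (auto simp: graph_covering_def)
  thus ?thesis
    using sum_edges_between_distinct[of v w "\<lambda>e. a (pd ` e)"]
      sum_edges_between_loops[OF graph_covering_finite_out_arcs[OF cov fin v], of "\<lambda>e. a (pd ` e)"]
    by (auto simp: jacobi_lift_def jacobi_def)
qed

lemma jacobi_lift_sym:
  assumes "graph_covering G r G0 r0 pv pd"
  shows "jacobi_lift G r pv pd a b v w = jacobi_lift G r pv pd a b w v"
proof -
  interpret bidirected_digraph G r using assms by (simp add: graph_covering_def)
  have sub: "edges_between G r v w \<subseteq> edges_between G r w v" for v w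
  proof
    fix e assume "e \<in> edges_between G r v w"
    then obtain d where d: "d \<in> arcs G" "tail G d = v" "head G d = w" "e = {d, r d}"
      by (auto simp: edges_between_def)
    hence "e = {r d, r (r d)} \<and> r d \<in> arcs G \<and> tail G (r d) = w \<and> head G (r d) = v"
      by (simp add: insert_commute)
    thus "e \<in> edges_between G r w v" unfolding edges_between_def by blast
  qed
  have "edges_between G r v w = edges_between G r w v" using sub by blast
  thus ?thesis by (simp add: jacobi_lift_def jacobi_def)
qed

text \<open>The arcs at \<open>v\<close> are grouped by their heads and then renamed by the
  bijection between stars. The set \<open>X\<close> is left open: it is the whole vertex set for a
  finite cover and the closed neighbourhood of \<open>v\<close> for the tree.\<close>

lemma jacobi_lift_sum:
  fixes f :: "'v \<Rightarrow> 'a::real_vector"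
  assumes cov: "graph_covering G r G0 r0 pv pd" and fin: "fin_digraph G0" and v: "v \<in> verts G"
    and X: "finite X" "v \<in> X" "head G ` out_arcs G v \<subseteq> X"
  shows "(\<Sum>w\<in>X. jacobi_lift G r pv pd a b v w *\<^sub>R f w)
    = sheet_op G0 (\<lambda>d. a {d, r0 d}) b pv (lift_head G pd) f v"
proof -
  have fo: "finite (out_arcs G v)" by (rule graph_covering_finite_out_arcs[OF cov fin v])
  have "(\<Sum>w\<in>X. jacobi_lift G r pv pd a b v w *\<^sub>R f w)
      = (\<Sum>w\<in>X. if v = w then b (pv v) *\<^sub>R f w else 0)
        + (\<Sum>w\<in>X. \<Sum>d | d \<in> out_arcs G v \<and> head G d = w. a {pd d, r0 (pd d)} *\<^sub>R f (head G d))"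
    unfolding sum.distrib[symmetric]
    by (intro sum.cong refl) (auto simp: jacobi_lift_eq[OF cov fin v] scaleR_add_left scaleR_sum_left)
  also have "(\<Sum>w\<in>X. \<Sum>d | d \<in> out_arcs G v \<and> head G d = w. a {pd d, r0 (pd d)} *\<^sub>R f (head G d))
      = (\<Sum>d\<in>out_arcs G v. a {pd d, r0 (pd d)} *\<^sub>R f (head G d))"
    using fo X by (intro sum.group) auto
  also have "\<dots> = (\<Sum>d\<in>out_arcs G v. a {pd d, r0 (pd d)} *\<^sub>R f (lift_head G pd v (pd d)))"
    using graph_covering_lift_head[OF cov] by (intro sum.cong refl) auto
  also have "\<dots> = (\<Sum>d\<in>out_arcs G0 (pv v). a {d, r0 d} *\<^sub>R f (lift_head G pd v d))"
    using cov v by (intro sum.reindex_bij_betw) (simp add: graph_covering_def)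
  finally show ?thesis using X by (simp add: sheet_op_def)
qed

text \<open>Every row of the matrix has finite support, so the infinite sum is a finite one for all
  \<open>f\<close>, square-summable or not.\<close>

lemma matrix_operator_jacobi_lift:
  assumes cov: "graph_covering G r G0 r0 pv pd" and fin: "fin_digraph G0"
  shows "matrix_operator (verts G) (jacobi_lift G r pv pd a b) f v =
    (if v \<in> verts G then sheet_op G0 (\<lambda>d. a {d, r0 d}) b pv (lift_head G pd) f v else 0)"
proof (cases "v \<in> verts G")
  case True
  interpret bidirected_digraph G r using cov by (simp add: graph_covering_def)
  define X where "X = insert v (head G ` out_arcs G v)"
  have X: "finite X" "v \<in> X" "head G ` out_arcs G v \<subseteq> X" "X \<subseteq> verts G"
    using graph_covering_finite_out_arcs[OF cov fin True] True by (auto simp: X_def)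
  have 0: "jacobi_lift G r pv pd a b v w = 0" if "w \<notin> X" for w
  proof -
    have "{d. d \<in> out_arcs G v \<and> head G d = w} = {}" using that by (auto simp: X_def)
    moreover have "v \<noteq> w" using that X by blast
    ultimately show ?thesis unfolding jacobi_lift_eq[OF cov fin True] by (simp only: sum.empty if_False add_0)
  qed
  have "(\<Sum>\<^sub>\<infinity>w\<in>verts G. complex_of_real (jacobi_lift G r pv pd a b v w) * f w)
      = (\<Sum>\<^sub>\<infinity>w\<in>X. complex_of_real (jacobi_lift G r pv pd a b v w) * f w)"
    by (rule infsum_cong_neutral) (use X 0 in auto)
  also have "\<dots> = (\<Sum>w\<in>X. jacobi_lift G r pv pd a b v w *\<^sub>R f w)"
    using X by (simp add: scaleR_conv_of_real)
  finally show ?thesis using True jacobi_lift_sum[OF cov fin True X(1-3)]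
    by (simp add: matrix_operator_def)
qed (simp add: matrix_operator_def)

section \<open>The second eigenvalue in terms of a test plane of functions on the vertices\<close>

lemma sorted_list_second_largest:
  fixes M :: "real multiset"
  assumes "size (filter_mset (\<lambda>x. x > c) M) \<ge> 2"
  shows "rev (sorted_list_of_multiset M) ! 1 > c"
proof -
  define ys where "ys = rev (sorted_list_of_multiset M)"
  have srt: "sorted (rev ys)" and M: "mset ys = M" by (simp_all add: ys_def)
  have len: "length (filter (\<lambda>x. x > c) ys) \<ge> 2"
    using assms by (metis M mset_filter size_mset)
  then obtain x y zs where ys: "ys = x # y # zs"
    by (cases ys rule: list.exhaust; cases "tl ys") (auto split: if_splits)
  have "y > c"
  proof (rule ccontr)
    assume y: "\<not> y > c"
    hence "filter (\<lambda>x. x > c) zs = []"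
      using srt by (force simp: ys sorted_append filter_empty_conv)
    thus False using len y by (auto simp: ys split: if_splits)
  qed
  thus ?thesis by (simp add: ys flip: ys_def)
qed

lemma eigval_2_greater:
  fixes J :: "'v \<Rightarrow> 'v \<Rightarrow> real"
  assumes V: "finite V" and sym: "\<And>v w. J v w = J w v"
    and form: "\<And>\<alpha> \<beta>. (\<alpha>, \<beta>) \<noteq> (0, 0) \<Longrightarrow>
      c * (\<Sum>v\<in>V. (\<alpha> * g v + \<beta> * h v)\<^sup>2)
        < (\<Sum>v\<in>V. (\<alpha> * g v + \<beta> * h v) * (\<Sum>w\<in>V. J v w * (\<alpha> * g w + \<beta> * h w)))"
  shows "eigval 2 V J > c"
proof -
  define vs where "vs = (SOME vs. distinct vs \<and> set vs = V)"
  have "\<exists>vs. distinct vs \<and> set vs = V" using finite_distinct_list[OF V] by blast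
  from someI_ex[OF this] have vs: "distinct vs" "set vs = V" unfolding vs_def by blast+
  define n where "n = card V"
  have n: "length vs = n" using vs by (simp add: n_def distinct_card[symmetric])
  have sumV: "(\<Sum>i<n. F (vs ! i)) = sum F V" for F :: "'v \<Rightarrow> real"
    using bij_betw_nth[OF vs(1) n[symmetric, THEN arg_cong[of _ _ lessThan]] vs(2)[symmetric]] 
    by (rule sum.reindex_bij_betw)
  define A where "A = matrix_on V J"
  have A: "A = mat n n (\<lambda>(i, j). J (vs ! i) (vs ! j))"
    by (simp add: A_def matrix_on_def Let_def vs_def n_def)
  have "size (filter_mset (\<lambda>x. x > c) (proots (char_poly A))) \<ge> 2"
  proof (rule two_eigenvalues_greater)
    show "A \<in> carrier_mat n n" by (simp add: A)
    show "A\<^sup>T = A" by (rule eq_matI) (auto simp: A sym)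
    show "vec n (\<lambda>i. g (vs ! i)) \<in> carrier_vec n" "vec n (\<lambda>i. h (vs ! i)) \<in> carrier_vec n" by auto
    fix \<alpha> \<beta> :: real assume ab: "(\<alpha>, \<beta>) \<noteq> (0, 0)"
    define q where "q v = \<alpha> * g v + \<beta> * h v" for v
    have x: "\<alpha> \<cdot>\<^sub>v vec n (\<lambda>i. g (vs ! i)) + \<beta> \<cdot>\<^sub>v vec n (\<lambda>i. h (vs ! i)) = vec n (\<lambda>i. q (vs ! i))"
      by (rule eq_vecI) (auto simp: q_def)
    have xx: "vec n (\<lambda>i. q (vs ! i)) \<bullet> vec n (\<lambda>i. q (vs ! i)) = (\<Sum>v\<in>V. (q v)\<^sup>2)"
      by (simp add: scalar_prod_def atLeast0LessThan power2_eq_square flip: sumV)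
    have xAx: "vec n (\<lambda>i. q (vs ! i)) \<bullet> (A *\<^sub>v vec n (\<lambda>i. q (vs ! i))) = (\<Sum>v\<in>V. q v * (\<Sum>w\<in>V. J v w * q w))"
      by (simp add: A scalar_prod_def atLeast0LessThan flip: sumV)
    show "c * ((\<alpha> \<cdot>\<^sub>v vec n (\<lambda>i. g (vs ! i)) + \<beta> \<cdot>\<^sub>v vec n (\<lambda>i. h (vs ! i))) \<bullet>
           (\<alpha> \<cdot>\<^sub>v vec n (\<lambda>i. g (vs ! i)) + \<beta> \<cdot>\<^sub>v vec n (\<lambda>i. h (vs ! i))))
         < (\<alpha> \<cdot>\<^sub>v vec n (\<lambda>i. g (vs ! i)) + \<beta> \<cdot>\<^sub>v vec n (\<lambda>i. h (vs ! i))) \<bullet>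
           (A *\<^sub>v (\<alpha> \<cdot>\<^sub>v vec n (\<lambda>i. g (vs ! i)) + \<beta> \<cdot>\<^sub>v vec n (\<lambda>i. h (vs ! i))))"
      unfolding x xx xAx using form[OF ab] by (simp add: q_def)
  qed
  from sorted_list_second_largest[OF this] show ?thesis by (simp add: eigval_def A_def)
qed

section \<open>The spectrum\<close>

lemma ell2D:
  assumes "f \<in> ell2 V"
  shows "v \<notin> V \<Longrightarrow> f v = 0" and "(\<lambda>v. (cmod (f v))\<^sup>2) summable_on V"
  using assms by (auto simp: ell2_def)

lemma ell2_norm_nonneg [simp]: "ell2_norm V f \<ge> 0"
  by (simp add: ell2_norm_def infsum_nonneg)

lemma L2_set_le_ell2_norm:
  assumes "f \<in> ell2 V" "finite X" "X \<subseteq> V"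
  shows "L2_set (\<lambda>v. cmod (f v)) X \<le> ell2_norm V f"
  unfolding L2_set_def ell2_norm_def
  using ell2D(2)[OF assms(1)] assms(2,3) by (intro real_sqrt_le_mono finite_sum_le_infsum) auto

lemma ell2_norm_le:
  assumes f: "\<And>v. v \<notin> V \<Longrightarrow> f v = 0"
    and bound: "\<And>X. finite X \<Longrightarrow> X \<subseteq> V \<Longrightarrow> L2_set (\<lambda>v. cmod (f v)) X \<le> C"
  shows "f \<in> ell2 V" "ell2_norm V f \<le> C"
proof -
  have C: "C \<ge> 0" using bound[of "{}"] by simp
  have sq: "(\<Sum>v\<in>X. (cmod (f v))\<^sup>2) \<le> C\<^sup>2" if "finite X" "X \<subseteq> V" for X
    using power_mono[OF bound[OF that], of 2] by (simp add: L2_set_def sum_nonneg)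
  have summ: "(\<lambda>v. (cmod (f v))\<^sup>2) summable_on V"
    by (rule nonneg_bdd_above_summable_on) (auto intro!: bdd_aboveI[of _ "C\<^sup>2"] sq)
  thus "f \<in> ell2 V" using f by (auto simp: ell2_def)
  have "(\<Sum>\<^sub>\<infinity>v\<in>V. (cmod (f v))\<^sup>2) \<le> C\<^sup>2"
    using summ sq by (rule infsum_le_finite_sums)
  thus "ell2_norm V f \<le> C" using C by (simp add: ell2_norm_def real_le_lsqrt)
qed

lemma ell2_add:
  assumes "f \<in> ell2 V" "g \<in> ell2 V"
  shows "(\<lambda>v. f v + g v) \<in> ell2 V" "ell2_norm V (\<lambda>v. f v + g v) \<le> ell2_norm V f + ell2_norm V g"
proof -
  have "L2_set (\<lambda>v. cmod (f v + g v)) X \<le> ell2_norm V f + ell2_norm V g" if X: "finite X" "X \<subseteq> V" for X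
  proof -
    have "L2_set (\<lambda>v. cmod (f v + g v)) X \<le> L2_set (\<lambda>v. cmod (f v) + cmod (g v)) X"
      by (intro L2_set_mono norm_triangle_ineq) auto
    also have "\<dots> \<le> L2_set (\<lambda>v. cmod (f v)) X + L2_set (\<lambda>v. cmod (g v)) X"
      by (rule L2_set_triangle_ineq)
    also have "\<dots> \<le> ell2_norm V f + ell2_norm V g"
      using assms X by (intro add_mono L2_set_le_ell2_norm)
    finally show ?thesis .
  qed
  note 1 = ell2_norm_le[of V "\<lambda>v. f v + g v", OF _ this]
  show "(\<lambda>v. f v + g v) \<in> ell2 V"
    by (rule 1(1)) (auto simp: assms[THEN ell2D(1)])
  show "ell2_norm V (\<lambda>v. f v + g v) \<le> ell2_norm V f + ell2_norm V g"
    by (rule 1(2)) (auto simp: assms[THEN ell2D(1)])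
qed

lemma ell2_scale:
  assumes "f \<in> ell2 V"
  shows "(\<lambda>v. c * f v) \<in> ell2 V" "ell2_norm V (\<lambda>v. c * f v) \<le> cmod c * ell2_norm V f"
proof -
  have "L2_set (\<lambda>v. cmod (c * f v)) X \<le> cmod c * ell2_norm V f" if X: "finite X" "X \<subseteq> V" for X
    using mult_left_mono[OF L2_set_le_ell2_norm[OF assms X], of "cmod c"]
    by (simp add: norm_mult L2_set_right_distrib)
  note 1 = ell2_norm_le[of V "\<lambda>v. c * f v", OF _ this]
  show "(\<lambda>v. c * f v) \<in> ell2 V"
    by (rule 1(1)) (auto simp: assms[THEN ell2D(1)])
  show "ell2_norm V (\<lambda>v. c * f v) \<le> cmod c * ell2_norm V f"
    by (rule 1(2)) (auto simp: assms[THEN ell2D(1)])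
qed

lemma ell2_diff:
  assumes "f \<in> ell2 V" "g \<in> ell2 V"
  shows "(\<lambda>v. f v - g v) \<in> ell2 V"
  using ell2_add(1)[OF assms(1) ell2_scale(1)[OF assms(2), of "-1"]] by simp

lemma cmod_le_ell2_norm:
  assumes "f \<in> ell2 V"
  shows "cmod (f v) \<le> ell2_norm V f"
proof (cases "v \<in> V")
  case True thus ?thesis using L2_set_le_ell2_norm[OF assms, of "{v}"] by simp
next
  case False thus ?thesis using ell2D(1)[OF assms] by simp
qed

text \<open>A Fatou argument: the uniform bound holds on each finite subset, where it survives the
  pointwise limit.\<close>

lemma ell2_tendsto_bound:
  assumes fn: "\<And>n. fn n \<in> ell2 V" "\<And>n. ell2_norm V (fn n) \<le> C"
    and lim: "\<And>v. (\<lambda>n. fn n v) \<longlonglongrightarrow> f v"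
  shows "f \<in> ell2 V"
proof (rule ell2_norm_le)
  fix v assume "v \<notin> V"
  thus "f v = 0" using lim[of v] ell2D(1)[OF fn(1)] by (simp add: LIMSEQ_const_iff)
next
  fix X assume X: "finite X" "X \<subseteq> V"
  have "(\<lambda>n. L2_set (\<lambda>v. cmod (fn n v)) X) \<longlonglongrightarrow> L2_set (\<lambda>v. cmod (f v)) X"
    unfolding L2_set_def by (intro tendsto_intros lim)
  thus "L2_set (\<lambda>v. cmod (f v)) X \<le> C"
    using order_trans[OF L2_set_le_ell2_norm[OF fn(1) X] fn(2)] by (intro LIMSEQ_le_const2) auto
qed

text \<open>
  The Neumann series of a contraction. Pointwise convergence is enough, so the completeness of
  \<open>\<ell>\<^sup>2\<close> is not needed, provided the contraction is pointwise continuous.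
\<close>

lemma ell2_contraction_bij:
  fixes K :: "('v \<Rightarrow> complex) \<Rightarrow> ('v \<Rightarrow> complex)"
  assumes q: "0 \<le> q" "q < 1"
    and add: "\<And>f g. K (\<lambda>v. f v + g v) = (\<lambda>v. K f v + K g v)"
    and scale: "\<And>c f. K (\<lambda>v. c * f v) = (\<lambda>v. c * K f v)"
    and contr: "\<And>f. f \<in> ell2 V \<Longrightarrow> K f \<in> ell2 V \<and> ell2_norm V (K f) \<le> q * ell2_norm V f"
    and cont: "\<And>fn f v. (\<And>u. (\<lambda>n. fn n u) \<longlonglongrightarrow> f u) \<Longrightarrow> (\<lambda>n. K (fn n) v) \<longlonglongrightarrow> K f v"
  shows "bij_betw (\<lambda>f v. f v - K f v) (ell2 V) (ell2 V)"
    and "\<And>f. f \<in> ell2 V \<Longrightarrow> ell2_norm V f \<le> 1 / (1 - q) * ell2_norm V (\<lambda>v. f v - K f v)"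
proof -
  show bound: "ell2_norm V f \<le> 1 / (1 - q) * ell2_norm V (\<lambda>v. f v - K f v)" if f: "f \<in> ell2 V" for f
  proof -
    have "ell2_norm V f = ell2_norm V (\<lambda>v. (f v - K f v) + K f v)" by simp
    also have "\<dots> \<le> ell2_norm V (\<lambda>v. f v - K f v) + ell2_norm V (K f)"
      using f contr[OF f] by (intro ell2_add(2) ell2_diff) auto
    also have "\<dots> \<le> ell2_norm V (\<lambda>v. f v - K f v) + q * ell2_norm V f" using contr[OF f] by simp
    finally show ?thesis using q by (simp add: field_simps)
  qed
  show "bij_betw (\<lambda>f v. f v - K f v) (ell2 V) (ell2 V)"
  proof (rule bij_betw_imageI)
    show "inj_on (\<lambda>f v. f v - K f v) (ell2 V)"
    proof (rule inj_onI)
      fix f g assume fg: "f \<in> ell2 V" "g \<in> ell2 V" and eq: "(\<lambda>v. f v - K f v) = (\<lambda>v. g v - K g v)"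
      define h where "h = (\<lambda>v. f v + (-1) * g v)"
      have h: "h \<in> ell2 V" using ell2_diff[OF fg] by (simp add: h_def)
      have "K h = (\<lambda>v. K f v + (-1) * K g v)" unfolding h_def add scale ..
      hence "h v - K h v = 0" for v using fun_cong[OF eq, of v] by (simp add: h_def algebra_simps)
      hence "ell2_norm V h \<le> 0" using bound[OF h] by (simp add: ell2_norm_def)
      hence "cmod (h v) \<le> 0" for v using cmod_le_ell2_norm[OF h, of v] by linarith
      thus "f = g" by (auto simp: h_def)
    qed
    show "(\<lambda>f v. f v - K f v) ` ell2 V = ell2 V"
    proof (intro equalityI subsetI)
      fix g assume g: "g \<in> ell2 V"
      define u where "u k = (K ^^ k) g" for k
      have u: "u k \<in> ell2 V \<and> ell2_norm V (u k) \<le> q ^ k * ell2_norm V g" for k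
      proof (induction k)
        case (Suc k)
        hence "q * ell2_norm V (u k) \<le> q ^ Suc k * ell2_norm V g"
          using q by (simp add: mult.assoc mult_left_mono)
        thus ?case using contr[of "u k"] Suc by (simp add: u_def)
      qed (use g in \<open>simp add: u_def\<close>)
      define fn where "fn n = (\<lambda>v. \<Sum>k<n. u k v)" for n
      have fn: "fn n \<in> ell2 V \<and> ell2_norm V (fn n) \<le> (\<Sum>k<n. q ^ k * ell2_norm V g)" for n
      proof (induction n)
        case 0
        have "(\<lambda>v. 0) \<in> ell2 V" by (simp add: ell2_def)
        thus ?case by (simp add: fn_def ell2_norm_def)
      next
        case (Suc n)
        have "fn (Suc n) = (\<lambda>v. fn n v + u n v)" by (simp add: fn_def)
        thus ?case using ell2_add[of "fn n" V "u n"] Suc u[of n] by auto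
      qed
      have geo: "summable (\<lambda>k. q ^ k * ell2_norm V g)"
        using q by (intro summable_mult2 summable_geometric) simp
      define f where "f v = (\<Sum>k. u k v)" for v
      have "summable (\<lambda>k. u k v)" for v
        using order_trans[OF cmod_le_ell2_norm conjunct2[OF u]] u
        by (intro summable_comparison_test'[OF geo, of 0]) blast
      hence lim: "(\<lambda>n. fn n v) \<longlonglongrightarrow> f v" for v
        unfolding fn_def f_def by (rule summable_LIMSEQ)
      have "f \<in> ell2 V"
      proof (rule ell2_tendsto_bound[OF _ _ lim])
        fix n show "fn n \<in> ell2 V" using fn by blast
        have "(\<Sum>k<n. q ^ k * ell2_norm V g) \<le> (\<Sum>k. q ^ k * ell2_norm V g)"
          using q geo by (intro sum_le_suminf) auto
        thus "ell2_norm V (fn n) \<le> (\<Sum>k. q ^ k * ell2_norm V g)" using fn[of n] by linarith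
      qed
      moreover have "g = (\<lambda>v. f v - K f v)"
      proof
        fix v
        have K0: "K (\<lambda>v. 0) = (\<lambda>v. 0)" using scale[of 0 g] by simp
        \<comment> \<open>\<open>K\<close> shifts the partial sums of the Neumann series by one
          index, so \<open>fn (Suc n) - K (fn n)\<close> telescopes to \<open>g\<close> for every
          \<open>n\<close>; pointwise continuity of \<open>K\<close> then gives the equation for the
          limit.\<close>
        have "K (fn n) = (\<lambda>v. \<Sum>k<n. u (Suc k) v)" for n
          by (induction n) (simp_all add: fn_def K0 add u_def)
        hence "fn (Suc n) v - K (fn n) v = g v" for n
          by (simp add: fn_def sum.lessThan_Suc_shift u_def del: sum.lessThan_Suc)
        moreover have "(\<lambda>n. fn (Suc n) v - K (fn n) v) \<longlonglongrightarrow> f v - K f v"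
          using lim cont[OF lim] by (intro tendsto_diff LIMSEQ_Suc)
        ultimately show "g v = f v - K f v" by (simp add: LIMSEQ_const_iff)
      qed
      ultimately show "g \<in> (\<lambda>f v. f v - K f v) ` ell2 V" by blast
    qed (use contr ell2_diff in auto)
  qed
qed

lemma sheet_op_linear:
  fixes f g :: "'v \<Rightarrow> 'a::real_algebra"
  shows "sheet_op G0 \<alpha> \<beta> p s (\<lambda>v. f v + g v) v = sheet_op G0 \<alpha> \<beta> p s f v + sheet_op G0 \<alpha> \<beta> p s g v"
    and "sheet_op G0 \<alpha> \<beta> p s (\<lambda>v. c * f v) v = c * sheet_op G0 \<alpha> \<beta> p s f v"
  by (simp_all add: sheet_op_def sum.distrib sum_distrib_left algebra_simps)

lemma sheet_op_cong:
  assumes "f v = g v" "\<And>d. d \<in> out_arcs G0 (p v) \<Longrightarrow> f (s v d) = g (s v d)"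
  shows "sheet_op G0 \<alpha> \<beta> p s f v = sheet_op G0 \<alpha> \<beta> p s g v"
  using assms by (simp add: sheet_op_def)

lemma cmod_diff_scaled_square:
  "(cmod (x - of_real t * y))\<^sup>2 = (cmod x)\<^sup>2 - 2 * t * Re (cnj x * y) + t\<^sup>2 * (cmod y)\<^sup>2"
  unfolding cmod_power2 by (simp add: power2_eq_square algebra_simps)

text \<open>
  Above the numerical range, \<open>z - A\<close> is inverted through the contraction \<open>1 - t (z - A)\<close> with
  small \<open>t > 0\<close>. As the operator is local, the estimates pass from finitely supported to
  arbitrary functions by restricting to a neighbourhood of a finite set.
\<close>

lemma not_in_ell2_spectrum:
  fixes A :: "('v \<Rightarrow> complex) \<Rightarrow> ('v \<Rightarrow> complex)"
  assumes sh: "sheets G0 r0 V p s" and fin: "fin_digraph G0"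
    and A: "\<And>f v. A f v = (if v \<in> V then sheet_op G0 \<alpha> \<beta> p s f v else 0)"
    and form: "\<And>F f. finite F \<Longrightarrow> F \<subseteq> V \<Longrightarrow> (\<And>v. v \<notin> F \<Longrightarrow> f v = 0) \<Longrightarrow>
       (\<Sum>v\<in>F. Re (cnj (f v) * sheet_op G0 \<alpha> \<beta> p s f v)) \<le> c * (\<Sum>v\<in>F. (cmod (f v))\<^sup>2)"
    and z: "Re z > c"
  shows "z \<notin> ell2_spectrum V A"
proof -
  interpret sheets G0 r0 V p s by (rule sh)
  interpret fin_digraph G0 by (rule fin)
  let ?N = "\<lambda>(f :: 'v \<Rightarrow> complex) X. \<Sum>v\<in>X. (cmod (f v))\<^sup>2"
  obtain M where M: "M \<ge> 0" "\<And>f F X. finite F \<Longrightarrow> finite X \<Longrightarrow> X \<subseteq> V \<Longrightarrow>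
       (\<And>t. t \<notin> F \<Longrightarrow> f t = 0) \<Longrightarrow> (\<Sum>v\<in>X. (cmod (sheet_op G0 \<alpha> \<beta> p s f v))\<^sup>2) \<le> M * (\<Sum>t\<in>F. (cmod (f t))\<^sup>2)"
    by (rule sheet_op_bounded[OF sh fin, where \<alpha> = \<alpha> and \<beta> = \<beta>]) (rule that; blast)
  define \<delta> where "\<delta> = Re z - c"
  define L where "L = 2 * (cmod z)\<^sup>2 + 2 * M"
  \<comment> \<open>\<open>L\<close> bounds the squared norm of \<open>z - A\<close>, so the squared
    norm of \<open>K\<close> is at most \<open>1 - 2 * t * \<delta> + t\<^sup>2 * L\<close>. The
    choice of \<open>t\<close> ensures \<open>t * L \<le> \<delta>\<close>, which reduces this to
    \<open>q\<^sup>2 = 1 - t * \<delta>\<close>; the summand \<open>\<delta>\<^sup>2\<close> in the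
    denominator ensures \<open>t * \<delta> < 1\<close>, so that \<open>q\<close> is a real square
    root, and the 1 keeps the quotients strictly below their bounds.\<close>
  define t where "t = \<delta> / (L + 1 + \<delta>\<^sup>2)"
  have \<delta>: "\<delta> > 0" and L: "L \<ge> 0" using z M by (auto simp: \<delta>_def L_def)
  have den: "L + 1 + \<delta>\<^sup>2 > 0" using L by (simp add: add_nonneg_pos add_pos_nonneg)
  have t: "t > 0" using \<delta> den by (simp add: t_def)
  have tL: "t * L \<le> \<delta>" and t\<delta>: "t * \<delta> < 1"
    using \<delta> L den mult_nonneg_nonneg[of \<delta> "\<delta>\<^sup>2"] by (auto simp: t_def divide_simps algebra_simps power2_eq_square)
  define q where "q = sqrt (1 - t * \<delta>)"
  have q: "0 \<le> q" "q < 1" and q2: "q\<^sup>2 = 1 - t * \<delta>"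
    using t\<delta> t \<delta> by (auto simp: q_def)
  define B where "B f v = z * f v - A f v" for f v
  define K where "K f v = f v - of_real t * B f v" for f v
  have fin_bound: "?N (K f) X \<le> q\<^sup>2 * ?N f F"
    if F: "finite F" "F \<subseteq> V" and f: "\<And>v. v \<notin> F \<Longrightarrow> f v = 0" and X: "finite X" "X \<subseteq> V" for F f X
  proof -
    \<comment> \<open>\<open>Y\<close> contains \<open>F\<close>, so the pairing with
      \<open>f\<close> is complete on it, and contains \<open>X\<close>, where the norm of
      \<open>K f\<close> is wanted.\<close>
    define Y where "Y = X \<union> F"
    have Y: "finite Y" "Y \<subseteq> V" "F \<subseteq> Y" using F X by (auto simp: Y_def)
    have op: "A f v = sheet_op G0 \<alpha> \<beta> p s f v" if "v \<in> Y" for v using that Y by (auto simp: A)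
    have NY: "?N f Y = ?N f F" using Y f by (intro sum.mono_neutral_right) auto
    have "(\<Sum>v\<in>Y. Re (cnj (f v) * B f v)) = (\<Sum>v\<in>F. Re (cnj (f v) * B f v))"
      using Y f by (intro sum.mono_neutral_right) auto
    also have "\<dots> = (\<Sum>v\<in>F. Re z * (cmod (f v))\<^sup>2 - Re (cnj (f v) * sheet_op G0 \<alpha> \<beta> p s f v))"
    proof (rule sum.cong)
      fix v assume "v \<in> F"
      moreover have "Re (cnj x * (z * x - y)) = Re z * (cmod x)\<^sup>2 - Re (cnj x * y)" for x y
        unfolding cmod_power2 by (simp add: power2_eq_square algebra_simps)
      ultimately show "Re (cnj (f v) * B f v) = Re z * (cmod (f v))\<^sup>2 - Re (cnj (f v) * sheet_op G0 \<alpha> \<beta> p s f v)"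
        using op Y(3) by (auto simp: B_def)
    qed simp
    also have "\<dots> \<ge> \<delta> * ?N f F"
      using form[OF F f] by (simp add: sum_subtractf \<delta>_def algebra_simps flip: sum_distrib_left)
    finally have form': "(\<Sum>v\<in>Y. Re (cnj (f v) * B f v)) \<ge> \<delta> * ?N f F" .
    have "?N (B f) Y \<le> (\<Sum>v\<in>Y. 2 * ((cmod z)\<^sup>2 * (cmod (f v))\<^sup>2) + 2 * (cmod (sheet_op G0 \<alpha> \<beta> p s f v))\<^sup>2)"
    proof (rule sum_mono)
      fix v assume v: "v \<in> Y"
      have "(cmod (B f v))\<^sup>2 \<le> (cmod (z * f v) + cmod (A f v))\<^sup>2"
        unfolding B_def by (intro power_mono norm_triangle_ineq4) simp
      also have "\<dots> \<le> 2 * (cmod (z * f v))\<^sup>2 + 2 * (cmod (A f v))\<^sup>2"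
        using sum_squares_bound[of "cmod (z * f v)" "cmod (A f v)"] by (simp add: power2_sum)
      finally show "(cmod (B f v))\<^sup>2 \<le> 2 * ((cmod z)\<^sup>2 * (cmod (f v))\<^sup>2) + 2 * (cmod (sheet_op G0 \<alpha> \<beta> p s f v))\<^sup>2"
        using op[OF v] by (simp add: norm_mult power_mult_distrib)
    qed
    also have "\<dots> = 2 * ((cmod z)\<^sup>2 * ?N f Y) + 2 * ?N (sheet_op G0 \<alpha> \<beta> p s f) Y"
      by (simp add: sum.distrib sum_distrib_left)
    also have "\<dots> \<le> 2 * ((cmod z)\<^sup>2 * ?N f F) + 2 * (M * ?N f F)"
      using M(2)[OF F(1) Y(1,2) f] NY by simp
    finally have BL: "?N (B f) Y \<le> L * ?N f F" by (simp add: L_def algebra_simps)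
    have N0: "?N f F \<ge> 0" by (simp add: sum_nonneg)
    have "?N (K f) X \<le> ?N (K f) Y" using Y by (intro sum_mono2) (auto simp: Y_def)
    also have "\<dots> = ?N f Y - 2 * t * (\<Sum>v\<in>Y. Re (cnj (f v) * B f v)) + t\<^sup>2 * ?N (B f) Y"
      unfolding K_def cmod_diff_scaled_square
      by (simp only: sum.distrib sum_subtractf sum_distrib_left)
    also have "\<dots> \<le> ?N f F - 2 * t * (\<delta> * ?N f F) + t\<^sup>2 * (L * ?N f F)"
      unfolding NY using form' BL t by (intro add_mono diff_mono mult_left_mono) auto
    also have "\<dots> = (1 - 2 * (t * \<delta>) + t * (t * L)) * ?N f F"
      by (simp add: algebra_simps power2_eq_square)
    also have "\<dots> \<le> q\<^sup>2 * ?N f F"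
      unfolding q2 using mult_left_mono[OF tL, of t] t N0 by (intro mult_right_mono) auto
    finally show ?thesis .
  qed
  have contr: "K f \<in> ell2 V \<and> ell2_norm V (K f) \<le> q * ell2_norm V f" if f: "f \<in> ell2 V" for f
  proof -
    have "L2_set (\<lambda>v. cmod (K f v)) X \<le> q * ell2_norm V f" if X: "finite X" "X \<subseteq> V" for X
    proof -
      define F where "F = X \<union> (\<Union>v\<in>X. s v ` out_arcs G0 (p v))"
      have F: "finite F" "F \<subseteq> V" using X step_in by (auto simp: F_def)
      define fF where "fF v = (if v \<in> F then f v else 0)" for v
      have "K f v = K fF v" if v: "v \<in> X" for v
      proof -
        have "sheet_op G0 \<alpha> \<beta> p s f v = sheet_op G0 \<alpha> \<beta> p s fF v"
          using v by (intro sheet_op_cong) (auto simp: fF_def F_def)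
        moreover have "f v = fF v" using v by (simp add: fF_def F_def)
        ultimately show ?thesis by (simp add: K_def B_def A)
      qed
      hence "?N (K f) X = ?N (K fF) X" by simp
      also have "\<dots> \<le> q\<^sup>2 * ?N fF F" by (rule fin_bound[OF F _ X]) (simp add: fF_def)
      also have "?N fF F = ?N f F" by (simp add: fF_def)
      finally have "sqrt (?N (K f) X) \<le> sqrt (q\<^sup>2 * ?N f F)" by (rule real_sqrt_le_mono)
      hence "L2_set (\<lambda>v. cmod (K f v)) X \<le> q * L2_set (\<lambda>v. cmod (f v)) F"
        using q(1) by (simp add: L2_set_def real_sqrt_mult)
      also have "\<dots> \<le> q * ell2_norm V f"
        using L2_set_le_ell2_norm[OF f F] q(1) by (rule mult_left_mono)
      finally show ?thesis .
    qed
    moreover have "K f v = 0" if "v \<notin> V" for v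
      using that ell2D(1)[OF f] by (simp add: K_def B_def A)
    ultimately show ?thesis using ell2_norm_le[of V "K f"] by blast
  qed
  have K_add: "K (\<lambda>v. f v + g v) = (\<lambda>v. K f v + K g v)"
    and K_scale: "K (\<lambda>v. a * f v) = (\<lambda>v. a * K f v)" for f g a
    by (auto simp: K_def B_def A sheet_op_linear algebra_simps)
  have K_cont: "(\<lambda>n. K (fn n) v) \<longlonglongrightarrow> K f v" if "\<And>u. (\<lambda>n. fn n u) \<longlonglongrightarrow> f u" for fn f v
    unfolding K_def B_def A sheet_op_def by (cases "v \<in> V") (auto intro!: tendsto_intros that)
  have bij: "bij_betw (\<lambda>f v. f v - K f v) (ell2 V) (ell2 V)"
    by (rule ell2_contraction_bij(1)[OF q]) (fact K_add K_scale contr K_cont)+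
  have K_inv: "ell2_norm V f \<le> 1 / (1 - q) * ell2_norm V (\<lambda>v. f v - K f v)" if "f \<in> ell2 V" for f
    by (rule ell2_contraction_bij(2)[OF q _ _ _ _ that]) (fact K_add K_scale contr K_cont)+
  \<comment> \<open>Since \<open>f - K f\<close> is \<open>t\<close> times \<open>z f - A f\<close>,
    the operator \<open>A - z\<close> is \<open>1 - K\<close> followed by multiplication by
    \<open>a\<close>, and both factors are invertible.\<close>
  define a where "a = - complex_of_real (1 / t)"
  have a: "a \<noteq> 0" using t by (simp add: a_def)
  have Az: "(\<lambda>v. A f v - z * f v) = (\<lambda>v. a * (f v - K f v))" for f
    using t by (auto simp: K_def B_def a_def field_simps)
  have scale_bij: "bij_betw (\<lambda>f v. a * f v) (ell2 V) (ell2 V)"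
    by (rule bij_betw_byWitness[of _ "\<lambda>f v. (1 / a) * f v"])
      (use a ell2_scale(1)[of _ V a] ell2_scale(1)[of _ V "1 / a"] in auto)
  have "bij_betw (\<lambda>f v. A f v - z * f v) (ell2 V) (ell2 V)"
    using bij_betw_trans[OF bij scale_bij] by (simp add: Az o_def)
  moreover have "ell2_norm V f \<le> (1 / (1 - q) * cmod (1 / a)) * ell2_norm V (\<lambda>v. A f v - z * f v)"
    if f: "f \<in> ell2 V" for f
  proof -
    have "(\<lambda>v. f v - K f v) \<in> ell2 V" using f contr by (intro ell2_diff) auto
    hence "(\<lambda>v. a * (f v - K f v)) \<in> ell2 V" by (rule ell2_scale)
    from ell2_scale(2)[OF this, of "1 / a"]
    have "ell2_norm V (\<lambda>v. f v - K f v) \<le> cmod (1 / a) * ell2_norm V (\<lambda>v. a * (f v - K f v))"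
      using a by simp
    hence "1 / (1 - q) * ell2_norm V (\<lambda>v. f v - K f v)
        \<le> 1 / (1 - q) * (cmod (1 / a) * ell2_norm V (\<lambda>v. a * (f v - K f v)))"
      using q by (intro mult_left_mono) auto
    with K_inv[OF f] show ?thesis unfolding Az mult.assoc by linarith
  qed
  ultimately show ?thesis unfolding ell2_spectrum_def by blast
qed

section \<open>The second eigenvalue of large covers\<close>

text \<open>A pigeonhole argument in the fibre \<open>P\<close> over the base point. All fibres have
  the size of \<open>P\<close>, so \<open>P\<close> has at least
  \<open>card V / card (verts G0)\<close> points. With \<open>x\<close> fixed arbitrarily, each
  \<open>t\<close> in \<open>F\<close> rules out at most \<open>card Z\<close> choices of
  \<open>y\<close>, because distinct base points give distinct images of \<open>t\<close>. The bound
  in the hypothesis leaves a point over.\<close>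

lemma (in tree_sheets) separated_sheets:
  assumes V: "finite V" and fin: "fin_digraph G0" and F: "finite F" "F \<subseteq> verts T"
    and card: "card (verts G0) * (card F * (card F * (1 + card (arcs G0)))) < card V"
    and t0: "t0 \<in> verts T"
  obtains x y where "x \<in> V" "p x = pvT t0" "y \<in> V" "p y = pvT t0" "sheet_map t0 x ` F \<inter> sheet_map t0 y ` F = {}"
    "\<And>t d. t \<in> F \<Longrightarrow> d \<in> out_arcs G0 (pvT t) \<Longrightarrow> s (sheet_map t0 x t) d \<notin> sheet_map t0 y ` F"
proof -
  interpret fin_digraph G0 by (rule fin)
  define P where "P = {x \<in> V. p x = pvT t0}"
  have P: "finite P" using V by (simp add: P_def)
  have Un: "V = (\<Union>u\<in>verts G0. {y \<in> V. p y = u})" using proj_in by auto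
  have "card V \<le> (\<Sum>u\<in>verts G0. card {y \<in> V. p y = u})"
    using card_UN_le[OF finite_verts, of "\<lambda>u. {y \<in> V. p y = u}"] by (simp only: Un[symmetric])
  also have "\<dots> = (\<Sum>u\<in>verts G0. card P)"
  proof (rule sum.cong)
    fix u assume "u \<in> verts G0"
    then obtain t where "t \<in> verts T" "u = pvT t" using cover unfolding graph_covering_def by blast
    thus "card {y \<in> V. p y = u} = card P" using bij_betw_same_card[OF bij_betw_sheet_map[OF t0], of t] by (simp add: P_def)
  qed simp
  finally have "card V \<le> card (verts G0) * card P" by simp
  with card have cardP: "card F * (card F * (1 + card (arcs G0))) < card P"
    by (meson le_trans mult_le_mono2 not_less)
  hence "P \<noteq> {}" by auto
  then obtain x where x: "x \<in> P" by blast
  \<comment> \<open>\<open>Z\<close> is the copy of \<open>F\<close> at \<open>x\<close> together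
    with all its neighbours: a second copy that avoids \<open>Z\<close> is both disjoint from the
    first and not adjacent to it.\<close>
  define Z where "Z = (\<Union>t\<in>F. insert (sheet_map t0 x t) (s (sheet_map t0 x t) ` out_arcs G0 (pvT t)))"
  have Zfin: "finite Z"
    unfolding Z_def using F(1) by (intro finite_UN_I finite.insertI finite_imageI finite_out_arcs)
  have "card Z \<le> (\<Sum>t\<in>F. card (insert (sheet_map t0 x t) (s (sheet_map t0 x t) ` out_arcs G0 (pvT t))))"
    unfolding Z_def using F(1) by (rule card_UN_le)
  also have "\<dots> \<le> (\<Sum>t\<in>F. 1 + card (arcs G0))"
  proof (rule sum_mono)
    fix t
    have "card (s (sheet_map t0 x t) ` out_arcs G0 (pvT t)) \<le> card (arcs G0)"
      by (rule le_trans[OF card_image_le[OF finite_out_arcs] card_mono[OF finite_arcs]]) auto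
    thus "card (insert (sheet_map t0 x t) (s (sheet_map t0 x t) ` out_arcs G0 (pvT t))) \<le> 1 + card (arcs G0)"
      by (intro card_insert_le_m1) auto
  qed
  finally have cardZ: "card Z \<le> card F * (1 + card (arcs G0))" by simp
  define B where "B = (\<Union>t\<in>F. {y \<in> P. sheet_map t0 y t \<in> Z})"
  have "card B \<le> (\<Sum>t\<in>F. card {y \<in> P. sheet_map t0 y t \<in> Z})"
    unfolding B_def using F(1) by (rule card_UN_le)
  also have "\<dots> \<le> (\<Sum>t\<in>F. card Z)"
  proof (rule sum_mono)
    fix t assume "t \<in> F"
    hence "inj_on (\<lambda>y. sheet_map t0 y t) P" using bij_betw_sheet_map[OF t0, of t] F by (auto simp: bij_betw_def P_def)
    hence "inj_on (\<lambda>y. sheet_map t0 y t) {y \<in> P. sheet_map t0 y t \<in> Z}" by (rule inj_on_subset) auto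
    thus "card {y \<in> P. sheet_map t0 y t \<in> Z} \<le> card Z" using Zfin by (intro card_inj_on_le) auto
  qed
  also have "\<dots> < card P"
    using le_less_trans[OF mult_le_mono2[OF cardZ] cardP] by simp
  finally have "card B < card P" .
  moreover have "finite B" unfolding B_def using F(1) P by (intro finite_UN_I finite_Collect_conjI) auto
  ultimately have "\<not> P \<subseteq> B" using card_mono[of B P] by linarith
  then obtain y where y: "y \<in> P" "y \<notin> B" by blast
  hence sep: "sheet_map t0 y t \<notin> Z" if "t \<in> F" for t using that by (auto simp: B_def)
  show ?thesis
  proof (rule that[of x y])
    show "sheet_map t0 x ` F \<inter> sheet_map t0 y ` F = {}" using sep by (fastforce simp: Z_def)
    fix t d assume "t \<in> F" "d \<in> out_arcs G0 (pvT t)"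
    hence "s (sheet_map t0 x t) d \<in> Z" by (auto simp: Z_def simp del: in_out_arcs_conv)
    thus "s (sheet_map t0 x t) d \<notin> sheet_map t0 y ` F" using sep by auto
  qed (use x y in \<open>auto simp: P_def\<close>)
qed

lemma sheet_op_nonzeroE:
  assumes "sheet_op G0 \<alpha> \<beta> p s f v \<noteq> 0"
  obtains "f v \<noteq> 0" | d where "d \<in> out_arcs G0 (p v)" "f (s v d) \<noteq> 0"
proof (cases "\<exists>d\<in>out_arcs G0 (p v). f (s v d) \<noteq> 0")
  case False
  hence "(\<Sum>d\<in>out_arcs G0 (p v). \<alpha> d *\<^sub>R f (s v d)) = 0" by (intro sum.neutral) auto
  thus ?thesis using assms that(1) by (auto simp: sheet_op_def)
qed (use that(2) in blast)

text \<open>The push-forwards at the two separated base points have no cross terms, neither in the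
  norm nor in the form. Each of them inherits the strict inequality from \<open>f\<close>, and the
  squares of the coefficients are nonnegative weights, so the inequality holds on their whole
  span.\<close>

lemma eigval_2_greater_of_cover_form:
  fixes f :: "'t \<Rightarrow> complex"
  assumes cov: "graph_covering G r G0 r0 pv pd" and finG: "fin_digraph G" and fin: "fin_digraph G0"
    and univ: "universal_cover T rT G0 r0 pvT pdT"
    and a: "\<And>d. d \<in> arcs G0 \<Longrightarrow> a {d, r0 d} \<ge> 0"
    and F: "finite F" "F \<subseteq> verts T" and supp: "\<And>t. t \<notin> F \<Longrightarrow> f t = 0"
    and form: "c * (\<Sum>t\<in>F. (cmod (f t))\<^sup>2)
      < (\<Sum>t\<in>F. Re (cnj (f t) * sheet_op G0 (\<lambda>d. a {d, r0 d}) b pvT (lift_head T pdT) f t))"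
    and card: "card (verts G0) * (card F * (card F * (1 + card (arcs G0)))) < card (verts G)"
  shows "eigval 2 (verts G) (jacobi_lift G r pv pd a b) > c"
proof -
  interpret G: fin_digraph G by (rule finG)
  interpret G0: fin_digraph G0 by (rule fin)
  interpret tree_sheets G0 r0 "verts G" pv "lift_head G pd" T rT pvT pdT
    by (intro tree_sheets.intro tree_sheets_axioms.intro graph_covering_sheets[OF cov] univ)
  obtain t0 where t0: "t0 \<in> verts T"
    using univ by (auto simp: universal_cover_def tree_def strongly_connected_def)
  let ?op = "sheet_op G0 (\<lambda>d. a {d, r0 d}) b pv (lift_head G pd) :: (_ \<Rightarrow> real) \<Rightarrow> _"
  note \<Phi> = sheet_map_in[OF t0] sheet_map_step[OF t0]
  obtain x y where x: "x \<in> verts G" "pv x = pvT t0" and y: "y \<in> verts G" "pv y = pvT t0"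
    and disj: "sheet_map t0 x ` F \<inter> sheet_map t0 y ` F = {}"
    and nadj: "\<And>t d. t \<in> F \<Longrightarrow> d \<in> out_arcs G0 (pvT t) \<Longrightarrow> lift_head G pd (sheet_map t0 x t) d \<notin> sheet_map t0 y ` F"
    using separated_sheets[OF G.finite_verts fin F card t0] by blast
  define g where "g u w = L2_set (\<lambda>t. cmod (f t)) {t\<in>F. sheet_map t0 u t = w}" for u w
  have g0: "g u w = 0" if "w \<notin> sheet_map t0 u ` F" for u w
  proof -
    have "{t\<in>F. sheet_map t0 u t = w} = {}" using that by auto
    thus ?thesis by (simp only: g_def L2_set_empty)
  qed
  have large: "c * (\<Sum>w\<in>verts G. (g u w)\<^sup>2) < (\<Sum>w\<in>verts G. g u w * ?op (g u) w)"
    if u: "u \<in> verts G" "pv u = pvT t0" for u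
  proof -
    have im: "sheet_map t0 u ` F \<subseteq> verts G" using \<Phi>(1)[OF _ u] F by auto
    have "(\<Sum>w\<in>verts G. (g u w)\<^sup>2) = (\<Sum>w\<in>sheet_map t0 u ` F. (g u w)\<^sup>2)"
      using im g0 by (intro sum.mono_neutral_right) auto
    also have "\<dots> = (\<Sum>t\<in>F. (cmod (f t))\<^sup>2)" unfolding g_def by (rule sum_L2_set_fibres[OF F(1)])
    finally have "c * (\<Sum>w\<in>verts G. (g u w)\<^sup>2)
      < (\<Sum>t\<in>F. Re (cnj (f t) * sheet_op G0 (\<lambda>d. a {d, r0 d}) b pvT (lift_head T pdT) f t))"
      using form by simp
    also have "\<dots> \<le> (\<Sum>w\<in>sheet_map t0 u ` F. g u w * ?op (g u) w)"
      by (rule pushforward_form_ge[OF sheets_axioms T_sheets.sheets_axioms fin _ _ _ F])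
        (use a supp \<Phi>(1)[OF _ u] \<Phi>(2)[OF _ u] in \<open>auto simp: g_def\<close>)
    also have "\<dots> = (\<Sum>w\<in>verts G. g u w * ?op (g u) w)"
      using im g0 by (intro sum.mono_neutral_left) auto
    finally show ?thesis .
  qed
  have xy: "g x w * g y w = 0" for w using disj g0 by (metis disjoint_iff mult_eq_0_iff)
  have xy_op: "g x w * ?op (g y) w = 0" for w
  proof (rule ccontr)
    assume *: "g x w * ?op (g y) w \<noteq> 0"
    then obtain t where t: "t \<in> F" "w = sheet_map t0 x t" using g0[of w x] by auto
    hence "pv w = pvT t" using \<Phi>(1)[OF _ x] F by auto
    moreover have "?op (g y) w \<noteq> 0" using * by simp
    ultimately show False
      using xy[of w] * nadj[OF t(1)] g0[of _ y] t(2) by (elim sheet_op_nonzeroE) auto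
  qed
  \<comment> \<open>\<open>nadj\<close> forbids only arcs that lead from the copy at
    \<open>x\<close> to the copy at \<open>y\<close>. An arc in the other direction is excluded by
    reversing it with \<open>rev_out\<close> and \<open>step_back\<close>.\<close>
  have yx_op: "g y w * ?op (g x) w = 0" for w
  proof (rule ccontr)
    assume *: "g y w * ?op (g x) w \<noteq> 0"
    then obtain t where t: "t \<in> F" "w = sheet_map t0 y t" using g0[of w y] by auto
    hence w: "w \<in> verts G" using \<Phi>(1)[OF _ y] F by auto
    have "?op (g x) w \<noteq> 0" using * by simp
    then obtain d where d: "d \<in> out_arcs G0 (pv w)" "g x (lift_head G pd w d) \<noteq> 0"
      using xy[of w] * by (elim sheet_op_nonzeroE) auto
    then obtain t' where t': "t' \<in> F" "lift_head G pd w d = sheet_map t0 x t'" using g0[of _ x] by blast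
    have "pv (sheet_map t0 x t') = pvT t'" using \<Phi>(1)[OF _ x] F t'(1) by auto
    hence "r0 d \<in> out_arcs G0 (pvT t')" using rev_out[OF w d(1)] t'(2) by simp
    from nadj[OF t'(1) this] have "w \<notin> sheet_map t0 y ` F" using step_back[OF w d(1)] t'(2) by simp
    thus False using t by blast
  qed
  show ?thesis
  proof (rule eigval_2_greater[where g = "g x" and h = "g y"])
    show "finite (verts G)" by simp
    show "jacobi_lift G r pv pd a b v w = jacobi_lift G r pv pd a b w v" for v w
      by (rule jacobi_lift_sym[OF cov])
    fix \<alpha> \<beta> :: real assume ab: "(\<alpha>, \<beta>) \<noteq> (0, 0)"
    let ?q = "\<lambda>v. \<alpha> * g x v + \<beta> * g y v"
    have op: "(\<Sum>w\<in>verts G. jacobi_lift G r pv pd a b v w * ?q w) = \<alpha> * ?op (g x) v + \<beta> * ?op (g y) v"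
      if v: "v \<in> verts G" for v
    proof -
      have "head G ` out_arcs G v \<subseteq> verts G" by (auto intro: G.head_in_verts)
      from jacobi_lift_sum[OF cov fin v G.finite_verts v this, of a b ?q]
      show ?thesis by (simp add: sheet_op_linear)
    qed
    have "(\<Sum>v\<in>verts G. ?q v * (\<Sum>w\<in>verts G. jacobi_lift G r pv pd a b v w * ?q w))
        = (\<Sum>v\<in>verts G. \<alpha>\<^sup>2 * (g x v * ?op (g x) v) + \<beta>\<^sup>2 * (g y v * ?op (g y) v))"
    proof (rule sum.cong)
      fix v assume v: "v \<in> verts G"
      have "?q v * (\<alpha> * ?op (g x) v + \<beta> * ?op (g y) v)
          = \<alpha>\<^sup>2 * (g x v * ?op (g x) v) + \<beta>\<^sup>2 * (g y v * ?op (g y) v)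
            + \<alpha> * \<beta> * (g x v * ?op (g y) v) + \<alpha> * \<beta> * (g y v * ?op (g x) v)"
        by (simp add: power2_eq_square algebra_simps)
      thus "?q v * (\<Sum>w\<in>verts G. jacobi_lift G r pv pd a b v w * ?q w)
          = \<alpha>\<^sup>2 * (g x v * ?op (g x) v) + \<beta>\<^sup>2 * (g y v * ?op (g y) v)"
        by (simp only: op[OF v] xy_op yx_op)
    qed simp
    hence Q: "(\<Sum>v\<in>verts G. ?q v * (\<Sum>w\<in>verts G. jacobi_lift G r pv pd a b v w * ?q w))
        = \<alpha>\<^sup>2 * (\<Sum>v\<in>verts G. g x v * ?op (g x) v) + \<beta>\<^sup>2 * (\<Sum>v\<in>verts G. g y v * ?op (g y) v)"
      by (simp add: sum.distrib sum_distrib_left)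
    have "(?q v)\<^sup>2 = \<alpha>\<^sup>2 * (g x v)\<^sup>2 + \<beta>\<^sup>2 * (g y v)\<^sup>2 + 2 * \<alpha> * \<beta> * (g x v * g y v)" for v
      by (simp add: power2_eq_square algebra_simps)
    hence N: "c * (\<Sum>v\<in>verts G. (?q v)\<^sup>2)
        = \<alpha>\<^sup>2 * (c * (\<Sum>v\<in>verts G. (g x v)\<^sup>2)) + \<beta>\<^sup>2 * (c * (\<Sum>v\<in>verts G. (g y v)\<^sup>2))"
      by (simp only: xy) (simp add: sum.distrib sum_distrib_left algebra_simps)
    show "c * (\<Sum>v\<in>verts G. (?q v)\<^sup>2)
        < (\<Sum>v\<in>verts G. ?q v * (\<Sum>w\<in>verts G. jacobi_lift G r pv pd a b v w * ?q w))"
    \<comment> \<open>At least one coefficient is nonzero; its term supplies the strict inequality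
      and the other term a weak one.\<close>
    proof (cases "\<alpha> = 0")
      case True
      hence "\<beta>\<^sup>2 > 0" using ab by simp
      thus ?thesis unfolding Q N using large[OF y] True by simp
    next
      case False
      hence "\<alpha>\<^sup>2 > 0" by simp
      thus ?thesis unfolding Q N using large[OF x] large[OF y]
        by (intro add_less_le_mono mult_strict_left_mono mult_left_mono) auto
    qed
  qed
qed

theorem theorem1p1:
  fixes G0 :: "('v0, 'd0) pre_digraph" and r0 :: "'d0 \<Rightarrow> 'd0"
    and a :: "'d0 set \<Rightarrow> real" and b :: "'v0 \<Rightarrow> real"
    and G :: "nat \<Rightarrow> ('v, 'd) pre_digraph" and r :: "nat \<Rightarrow> 'd \<Rightarrow> 'd"
    and pv :: "nat \<Rightarrow> 'v \<Rightarrow> 'v0" and pd :: "nat \<Rightarrow> 'd \<Rightarrow> 'd0"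
    and T :: "('vt, 'dt) pre_digraph" and rT :: "'dt \<Rightarrow> 'dt"
    and pvT :: "'vt \<Rightarrow> 'v0" and pdT :: "'dt \<Rightarrow> 'd0"
  assumes "bidirected_digraph G0 r0" and "fin_digraph G0" and "strongly_connected G0"
    and "\<And>v. v \<in> verts G0 \<Longrightarrow> out_degree G0 v \<noteq> 1"
    and "\<And>e. e \<in> edges G0 r0 \<Longrightarrow> a e > 0"
    and "\<And>n. n \<ge> 1 \<Longrightarrow> fin_digraph (G n)"
    and "\<And>n. n \<ge> 1 \<Longrightarrow> graph_covering (G n) (r n) G0 r0 (pv n) (pd n)"
    and "filterlim (\<lambda>n. card (verts (G n))) at_top sequentially"
    and "universal_cover T rT G0 r0 pvT pdT"
  shows "liminf (\<lambda>n. ereal (eigval 2 (verts (G n)) (jacobi_lift (G n) (r n) (pv n) (pd n) a b)))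
     \<ge> (SUP z\<in>ell2_spectrum (verts T)
            (matrix_operator (verts T) (jacobi_lift T rT pvT pdT a b)). ereal (Re z))"
proof (rule SUP_least, rule ccontr)
  fix z
  let ?A = "matrix_operator (verts T) (jacobi_lift T rT pvT pdT a b)"
  let ?ev = "\<lambda>n. eigval 2 (verts (G n)) (jacobi_lift (G n) (r n) (pv n) (pd n) a b)"
  assume z: "z \<in> ell2_spectrum (verts T) ?A" and "\<not> ereal (Re z) \<le> liminf (\<lambda>n. ereal (?ev n))"
  hence less: "liminf (\<lambda>n. ereal (?ev n)) < ereal (Re z)" by simp
  \<comment> \<open>A real number strictly between is needed: the covers yield only
    \<open>c \<le> liminf\<close>, and the resolvent argument needs a gap below
    \<open>Re z\<close>.\<close>
  obtain c where c: "liminf (\<lambda>n. ereal (?ev n)) < ereal c" "c < Re z"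
    using ereal_dense2[OF less] by auto
  have coverT: "graph_covering T rT G0 r0 pvT pdT" using assms(9) by (simp add: universal_cover_def)
  have "z \<notin> ell2_spectrum (verts T) ?A"
  proof (rule not_in_ell2_spectrum[OF graph_covering_sheets[OF coverT] assms(2)])
    show "?A f v = (if v \<in> verts T then sheet_op G0 (\<lambda>d. a {d, r0 d}) b pvT (lift_head T pdT) f v else 0)" for f v
      by (rule matrix_operator_jacobi_lift[OF coverT assms(2)])
    show "c < Re z" by (rule c(2))
    fix F and f :: "'vt \<Rightarrow> complex"
    assume F: "finite F" "F \<subseteq> verts T" and supp: "\<And>v. v \<notin> F \<Longrightarrow> f v = 0"
    show "(\<Sum>v\<in>F. Re (cnj (f v) * sheet_op G0 (\<lambda>d. a {d, r0 d}) b pvT (lift_head T pdT) f v))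
        \<le> c * (\<Sum>v\<in>F. (cmod (f v))\<^sup>2)"
    proof (rule ccontr)
      assume large: "\<not> ?thesis"
      \<comment> \<open>The violating \<open>f\<close> and its support \<open>F\<close> are fixed
        before \<open>n\<close>, so this threshold is one number and all large covers exceed it. The
        restriction to \<open>n \<ge> 1\<close> below reflects that the sequence of covers starts at
        1.\<close>
      define N where "N = card (verts G0) * (card F * (card F * (1 + card (arcs G0))))"
      have "\<forall>\<^sub>F n in sequentially. card (verts (G n)) > N"
        using assms(8)[unfolded filterlim_at_top, rule_format, of "Suc N"] by (simp add: Suc_le_eq)
      hence "\<forall>\<^sub>F n in sequentially. ereal c \<le> ereal (?ev n)"
        using eventually_ge_at_top[of 1]
      proof eventually_elim
        case (elim n)
        have "c < ?ev n"
        proof (rule eigval_2_greater_of_cover_form[OF assms(7)[OF elim(2)] assms(6)[OF elim(2)] assms(2) assms(9) _ F supp large[unfolded not_le] elim(1)[unfolded N_def]])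
          show "0 \<le> a {d, r0 d}" if "d \<in> arcs G0" for d
            using assms(5)[of "{d, r0 d}"] that unfolding edges_def by (blast intro: less_imp_le)
        qed
        thus ?case by simp
      qed
      hence "ereal c \<le> liminf (\<lambda>n. ereal (?ev n))" by (rule Liminf_bounded)
      thus False using c(1) by simp
    qed
  qed
  thus False using z by blast
qed

end
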